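(* Let $n\ge 1$ be fixed. For each $d$ there exists a uniform determinantal representation $M=M_0+M_1$ of the generic $n$-variate polynomial $p_{n,d}$ of degree $d$ of size $\frac{1}{n\cdot n!}\,d^n+O(d^{n-1})$ (as $d\to\infty$) such that, moreover, the singular matrix space represented by $M_0$ is a compression space with a one-dimensional witness. Moreover, under this additional condition on $M_0$ the bound is sharp: the size $N$ of any uniform determinantal representation $M=M_0+M_1$ of $p_{n,d}$ for which the matrix space represented by $M_0$ is a compression space with a one-dimensional witness satisfies $N\ge \frac{1}{n\cdot n!}\,d^n+O(d^{n-1})$ as $d\to\infty$.
   Context: Let $K$ be a field. The generic polynomial of degree $d$ in $n$ variables is $p_{n,d}=\sum_{|\alpha|\le d} c_\alpha x^\alpha$, where $x=(x_1,\ldots,x_n)$, $\alpha\in\mathbb{Z}_{\ge 0}^n$, $|\alpha|=\sum_i\alpha_i$, and each $c_\alpha$ is regarded as a variable. A uniform determinantal representation of $p_{n,d}$ of size $N$ is an $N\times N$ matrix $M$ whose entries are $K$-linear combinations of the monomials $1,x_i,c_\alpha,c_\alpha x_i$ ($1\le i\le n$, $|\alpha|\le d$), such that $\det(M)=p_{n,d}$. One writes $M=M_0+M_1$, where $M_0$ contains all terms of $M$ not containing any $c_\alpha$ and $M_1$ contains all terms that do. Writing $M_0=B_0+\sum_{i=1}^n x_iB_i$ with $B_i\in K^{N\times N}$, the matrix space represented by $M_0$ is the linear span $\langle B_0,\ldots,B_n\rangle_K\subseteq K^{N\times N}$. A subspace $\mathcal{A}\subseteq K^{N\times N}$ is a compression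 space if there exists a subspace $U\subseteq K^N$ with $\dim\langle u^TA\mid A\in\mathcal{A},u\in U\rangle_K<\dim U$; such a $U$ is called a witness. *)

theory Defs
  imports
    "HOL-Library.Poly_Mapping"
    "HOL-Library.Landau_Symbols"
    "Jordan_Normal_Form.VS_Connect"
begin

text \<open>
  The coordinates of \<open>x = (x\<^sub>1, \<dots>, x\<^sub>n)\<close> are indexed by \<open>0, \<dots>, n - 1\<close>. A multi-index is a
  finitely supported function \<open>nat \<Rightarrow>\<^sub>0 nat\<close> whose support lies in \<open>{..<n}\<close>.
\<close>

type_synonym multi_index = "nat \<Rightarrow>\<^sub>0 nat"

definition multi_indices :: "nat \<Rightarrow> nat \<Rightarrow> multi_index set" where
  "multi_indices n d =
     {\<alpha>. Poly_Mapping.keys \<alpha> \<subseteq> {..<n} \<and> (\<Sum>i<n. Poly_Mapping.lookup \<alpha> i) \<le> d}"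

lemma finite_multi_indices: "finite (multi_indices n d)"
proof -
  have "Poly_Mapping.lookup ` multi_indices n d \<subseteq>
    {f. \<forall>x. (x \<in> {..<n} \<longrightarrow> f x \<in> {..d}) \<and> (x \<notin> {..<n} \<longrightarrow> f x = 0)}" (is "_ \<subseteq> ?F")
  proof clarify
    fix \<alpha> x
    assume a: "\<alpha> \<in> multi_indices n d"
    have "Poly_Mapping.lookup \<alpha> x \<le> d" if "x < n"
    proof -
      have "Poly_Mapping.lookup \<alpha> x \<le> (\<Sum>i<n. Poly_Mapping.lookup \<alpha> i)"
        using that by (intro member_le_sum) auto
      with a show ?thesis by (simp add: multi_indices_def)
    qed
    moreover have "Poly_Mapping.lookup \<alpha> x = 0" if "\<not> x < n"
      using a that by (auto simp: multi_indices_def in_keys_iff)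
    ultimately show "(x \<in> {..<n} \<longrightarrow> Poly_Mapping.lookup \<alpha> x \<in> {..d}) \<and>
        (x \<notin> {..<n} \<longrightarrow> Poly_Mapping.lookup \<alpha> x = 0)" by simp
  qed
  moreover have "finite ?F" by (rule finite_set_of_finite_funs) auto
  ultimately have "finite (Poly_Mapping.lookup ` multi_indices n d)"
    by (rule finite_subset)
  moreover have "inj_on Poly_Mapping.lookup (multi_indices n d)"
    by (simp add: inj_on_def)
  ultimately show ?thesis by (rule finite_imageD)
qed

text \<open>
  The polynomial ring over \<open>K\<close> in the variables \<open>x\<^sub>i\<close> and \<open>c\<^sub>\<alpha>\<close>: the monoid algebra of the
  free commutative monoid on these variables. Here \<open>n\<close> and \<open>d\<close> are not part of the type;
  they are imposed on the polynomials below.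
\<close>

datatype pvar = Xvar nat | Cvar multi_index

type_synonym 'k cpoly = "(pvar \<Rightarrow>\<^sub>0 nat) \<Rightarrow>\<^sub>0 'k"

definition var :: "pvar \<Rightarrow> 'k::field cpoly" where
  "var v = Poly_Mapping.single (Poly_Mapping.single v 1) 1"

definition x_monom :: "nat \<Rightarrow> multi_index \<Rightarrow> 'k::field cpoly" where
  "x_monom n \<alpha> = (\<Prod>i<n. var (Xvar i) ^ Poly_Mapping.lookup \<alpha> i)"

definition generic_poly :: "nat \<Rightarrow> nat \<Rightarrow> 'k::field cpoly" where
  "generic_poly n d = (\<Sum>\<alpha>\<in>multi_indices n d. var (Cvar \<alpha>) * x_monom n \<alpha>)"

text \<open>The \<open>K\<close>-vector space structure on the polynomial ring; it provides \<open>cpoly.span\<close>.\<close>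

interpretation cpoly: vector_space
  "\<lambda>(a::'k::field) (p::'k cpoly). Poly_Mapping.single 0 a * p"
proof unfold_locales
  fix a b :: 'k and p q :: "'k cpoly"
  show "Poly_Mapping.single 0 a * (p + q) =
      Poly_Mapping.single 0 a * p + Poly_Mapping.single 0 a * q"
    by (rule distrib_left)
  show "Poly_Mapping.single 0 (a + b) * p =
      Poly_Mapping.single 0 a * p + Poly_Mapping.single 0 b * p"
    by (simp only: single_add distrib_right)
  show "Poly_Mapping.single 0 a * (Poly_Mapping.single 0 b * p) =
      Poly_Mapping.single 0 (a * b) * p"
    by (simp only: mult.assoc [symmetric] mult_single add_0_left)
  show "Poly_Mapping.single 0 1 * p = p"
    by (simp only: single_one mult_1_left)
qed

definition allowed_monomials :: "nat \<Rightarrow> nat \<Rightarrow> 'k::field cpoly set" where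
  "allowed_monomials n d =
     {1} \<union> {var (Xvar i) | i. i < n}
     \<union> {var (Cvar \<alpha>) | \<alpha>. \<alpha> \<in> multi_indices n d}
     \<union> {var (Cvar \<alpha>) * var (Xvar i) | \<alpha> i. \<alpha> \<in> multi_indices n d \<and> i < n}"

definition uniform_det_rep :: "nat \<Rightarrow> nat \<Rightarrow> nat \<Rightarrow> 'k::field cpoly mat \<Rightarrow> bool" where
  "uniform_det_rep n d N M \<longleftrightarrow>
     M \<in> carrier_mat N N \<and>
     (\<forall>i<N. \<forall>j<N. M $$ (i, j) \<in> cpoly.span (allowed_monomials n d)) \<and>
     det M = generic_poly n d"

text \<open>The summand \<open>M\<^sub>0\<close> of \<open>M = M\<^sub>0 + M\<^sub>1\<close>: all terms in which no \<open>c\<^sub>\<alpha>\<close> occurs.\<close>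

definition c_free_part :: "'k::field cpoly \<Rightarrow> 'k cpoly" where
  "c_free_part p =
     (\<Sum>m\<in>{m \<in> Poly_Mapping.keys p. Poly_Mapping.keys m \<inter> range Cvar = {}}.
        Poly_Mapping.single m (Poly_Mapping.lookup p m))"

definition M0_part :: "'k::field cpoly mat \<Rightarrow> 'k cpoly mat" where
  "M0_part M = map_mat c_free_part M"

text \<open>
  For \<open>M\<^sub>0 = B\<^sub>0 + \<Sum>\<^sub>i x\<^sub>i B\<^sub>i\<close>, the matrix \<open>B\<^sub>0\<close> collects the coefficients of the monomial
  \<open>1\<close> (exponent vector \<open>0\<close>) and \<open>B\<^sub>i\<close> those of the monomial \<open>x\<^sub>i\<close>.
\<close>

definition coeff_mat :: "(pvar \<Rightarrow>\<^sub>0 nat) \<Rightarrow> 'k::field cpoly mat \<Rightarrow> 'k mat" where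
  "coeff_mat m A = map_mat (\<lambda>p. Poly_Mapping.lookup p m) A"

definition matrix_space :: "nat \<Rightarrow> nat \<Rightarrow> 'k::field cpoly mat \<Rightarrow> 'k mat set" where
  "matrix_space n N A =
     LinearCombinations.module.span class_ring (module_mat TYPE('k) N N)
       (insert (coeff_mat 0 A) {coeff_mat (Poly_Mapping.single (Xvar i) 1) A | i. i < n})"

definition singular_space :: "'k::field mat set \<Rightarrow> bool" where
  "singular_space \<A> \<longleftrightarrow> (\<forall>A\<in>\<A>. det A = 0)"

definition vec_dim :: "nat \<Rightarrow> 'k::field vec set \<Rightarrow> nat" where
  "vec_dim N U = vectorspace.dim class_ring ((module_vec TYPE('k) N)\<lparr>carrier := U\<rparr>)"

text \<open>Row vectors \<open>u\<^sup>T A\<close> are represented by the vectors \<open>A\<^sup>T u\<close>.\<close>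

definition row_image :: "nat \<Rightarrow> 'k::field mat set \<Rightarrow> 'k vec set \<Rightarrow> 'k vec set" where
  "row_image N \<A> U =
     LinearCombinations.module.span class_ring (module_vec TYPE('k) N)
       {transpose_mat A *\<^sub>v u | A u. A \<in> \<A> \<and> u \<in> U}"

definition compression_witness :: "nat \<Rightarrow> 'k::field mat set \<Rightarrow> 'k vec set \<Rightarrow> bool" where
  "compression_witness N \<A> U \<longleftrightarrow>
     VectorSpace.subspace class_ring U (module_vec TYPE('k) N) \<and>
     vec_dim N (row_image N \<A> U) < vec_dim N U"

definition compression_space :: "nat \<Rightarrow> 'k::field mat set \<Rightarrow> bool" where
  "compression_space N \<A> \<longleftrightarrow>
     VectorSpace.subspace class_ring \<A> (module_mat TYPE('k) N N) \<and>
     (\<exists>U. compression_witness N \<A> U)"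

end

theory Submission
  imports Defs
begin

text \<open>
  A one-dimensional witness is a nonzero vector \<open>u\<close> with \<open>u\<^sup>T M\<^sub>0 = 0\<close>, so after a row operation
  one row of \<open>M\<close>, the special row, consists of terms containing some \<open>c\<^sub>\<alpha>\<close>.

  Lower bound. Expand the determinant along the special row and compare the coefficients of
  \<open>c\<^sub>\<alpha>\<close> at \<open>c = 0\<close>: with \<open>C\<^sub>j\<close> the maximal minors of the other \<open>N - 1\<close> rows of \<open>M\<^sub>0\<close>, all \<open>x\<^sup>\<alpha>\<close>
  with \<open>|\<alpha>| \<le> d\<close> are linear combinations of the \<open>N (n + 1)\<close> polynomials \<open>C\<^sub>j\<close> and \<open>x\<^sub>i C\<^sub>j\<close>. These
  polynomials satisfy \<open>N - 1\<close> linear relations, one for each of the other rows, which are linearly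
  independent as the determinant is not zero. Hence \<open>(n + d choose n) \<le> n N + 1\<close>. This is
  \<open>left_kernel_card_bound\<close> and \<open>one_dim_witness_card_bound\<close>.

  Upper bound. Let \<open>S\<close> be a finite set of exponents containing \<open>0\<close> in which every other element
  arises from an element of \<open>S\<close> by raising one coordinate. The monomials \<open>x\<^sup>\<alpha>\<close> with \<open>\<alpha> \<in> S\<close> are,
  up to sign, the maximal minors of the matrix with columns indexed by \<open>S\<close> that has, for each edge
  from \<open>\<beta>\<close> to \<open>\<alpha>\<close> of a spanning tree of \<open>S\<close> in direction \<open>v\<close>, a row with the entries \<open>1\<close> at \<open>\<alpha>\<close> and
  \<open>- x\<^sub>v\<close> at \<open>\<beta>\<close>. If moreover every \<open>\<alpha>\<close> with \<open>|\<alpha>| \<le> d\<close> is in \<open>S\<close> or one step above an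
  element of \<open>S\<close>, then a special row can be added to obtain a representation of size \<open>|S|\<close>
  (\<open>uniform_det_rep_of_connected_set\<close>).

  Such a set is given by the \<open>\<alpha>\<close> with \<open>|\<alpha>| \<le> d\<close> and \<open>n\<close> dividing \<open>0 \<alpha>\<^sub>0 + 1 \<alpha>\<^sub>1 + \<dots> + (n - 1) \<alpha>\<^bsub>n-1\<^esub>\<close>,
  together with all those that have a zero coordinate: lowering coordinate \<open>r\<close> lowers the sum by \<open>r\<close>, so an
  \<open>\<alpha>\<close> without zero coordinates whose sum is \<open>r\<close> modulo \<open>n\<close> is one step above \<open>S\<close> in direction \<open>r\<close>,
  and an element of \<open>S\<close> without zero coordinates stays in \<open>S\<close> when its coordinate \<open>0\<close> is lowered. The
  divisibility condition has density \<open>1 / n\<close> and there are only \<open>O(d\<^bsup>n-1\<^esup>)\<close> exponents with a zero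
  coordinate (\<open>card_connected_cover\<close>).
\<close>

section \<open>Parts of a polynomial of degree zero and one in the coefficient variables\<close>

lemma additive_eqI:
  fixes F G :: "('a \<Rightarrow>\<^sub>0 'b::comm_monoid_add) \<Rightarrow> 'c::comm_monoid_add"
  assumes "\<And>p q. F (p + q) = F p + F q" "\<And>p q. G (p + q) = G p + G q"
    and single: "\<And>m a. F (Poly_Mapping.single m a) = G (Poly_Mapping.single m a)"
  shows "F p = G p"
proof (induction p rule: Poly_Mapping.update_induct)
  case const
  show ?case using single[of undefined 0] by simp
next
  case (update f k v)
  have "Poly_Mapping.update k v f = f + Poly_Mapping.single k v"
    using update(1)
    by (intro poly_mapping_eqI) (auto simp: lookup_update lookup_add lookup_single in_keys_iff)
  then show ?case using update by (simp add: assms)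
qed

text \<open>The monomials in the \<open>x\<^sub>i\<close> alone.\<close>
definition c_free :: "(pvar \<Rightarrow>\<^sub>0 nat) \<Rightarrow> bool" where
  "c_free m \<longleftrightarrow> (\<forall>\<gamma>. Poly_Mapping.lookup m (Cvar \<gamma>) = 0)"

text \<open>The monomials of the form \<open>c\<^sub>\<alpha>\<close> times a monomial in the \<open>x\<^sub>i\<close> alone.\<close>
definition c_linear :: "multi_index \<Rightarrow> (pvar \<Rightarrow>\<^sub>0 nat) \<Rightarrow> bool" where
  "c_linear \<alpha> m \<longleftrightarrow> (\<forall>\<gamma>. Poly_Mapping.lookup m (Cvar \<gamma>) = (if \<gamma> = \<alpha> then 1 else 0))"

text \<open>
  The coefficient of \<open>c\<^sub>\<alpha>\<close> in the part of \<open>p\<close> that is linear in the variables \<open>c\<^sub>\<beta>\<close>: the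
  derivative by \<open>c\<^sub>\<alpha>\<close> evaluated at \<open>c = 0\<close>, a polynomial in the \<open>x\<^sub>i\<close> alone.
\<close>
definition c_coeff :: "multi_index \<Rightarrow> 'k::field cpoly \<Rightarrow> 'k cpoly" where
  "c_coeff \<alpha> p = (\<Sum>m\<in>Poly_Mapping.keys p. if c_linear \<alpha> m
     then Poly_Mapping.single (m - Poly_Mapping.single (Cvar \<alpha>) 1) (Poly_Mapping.lookup p m) else 0)"

lemma c_free_iff: "c_free m \<longleftrightarrow> Poly_Mapping.keys m \<inter> range Cvar = {}"
  by (auto simp: c_free_def in_keys_iff disjoint_iff)

lemma c_free_part_alt:
  "c_free_part p = (\<Sum>m\<in>Poly_Mapping.keys p. if c_free m
     then Poly_Mapping.single m (Poly_Mapping.lookup p m) else 0)"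
  unfolding c_free_part_def c_free_iff[symmetric] by (rule sum.inter_filter) simp

lemma c_free_part_add: "c_free_part (p + q) = c_free_part p + c_free_part q"
  unfolding c_free_part_alt by (rule setsum_keys_plus_distrib) (auto simp: single_add)

lemma c_coeff_add: "c_coeff \<alpha> (p + q) = c_coeff \<alpha> p + c_coeff \<alpha> q"
  unfolding c_coeff_def by (rule setsum_keys_plus_distrib) (auto simp: single_add)

lemma c_free_part_single:
  "c_free_part (Poly_Mapping.single m a) = (if c_free m then Poly_Mapping.single m a else 0)"
  by (auto simp: c_free_part_alt)

lemma c_coeff_single:
  "c_coeff \<alpha> (Poly_Mapping.single m a) = (if c_linear \<alpha> m
     then Poly_Mapping.single (m - Poly_Mapping.single (Cvar \<alpha>) 1) a else 0)"
  by (auto simp: c_coeff_def)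

lemma c_free_part_0: "c_free_part 0 = 0"
  by (simp add: c_free_part_alt)

lemma c_free_add: "c_free (m + l) \<longleftrightarrow> c_free m \<and> c_free l"
  by (auto simp: c_free_def lookup_add)

lemma c_linear_add:
  "c_linear \<alpha> (m + l) \<longleftrightarrow> c_linear \<alpha> m \<and> c_free l \<or> c_free m \<and> c_linear \<alpha> l"
proof
  assume *: "c_linear \<alpha> (m + l)"
  have "Poly_Mapping.lookup m (Cvar \<alpha>) + Poly_Mapping.lookup l (Cvar \<alpha>) = 1"
    using * by (simp add: c_linear_def lookup_add)
  then consider "Poly_Mapping.lookup m (Cvar \<alpha>) = 1" "Poly_Mapping.lookup l (Cvar \<alpha>) = 0" |
    "Poly_Mapping.lookup m (Cvar \<alpha>) = 0" "Poly_Mapping.lookup l (Cvar \<alpha>) = 1"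
    by linarith
  moreover have "\<forall>\<gamma>. \<gamma> \<noteq> \<alpha> \<longrightarrow> Poly_Mapping.lookup m (Cvar \<gamma>) = 0 \<and> Poly_Mapping.lookup l (Cvar \<gamma>) = 0"
  proof (intro allI impI)
    fix \<gamma> assume "\<gamma> \<noteq> \<alpha>"
    then have "Poly_Mapping.lookup (m + l) (Cvar \<gamma>) = 0" using * by (simp add: c_linear_def)
    then show "Poly_Mapping.lookup m (Cvar \<gamma>) = 0 \<and> Poly_Mapping.lookup l (Cvar \<gamma>) = 0"
      by (simp add: lookup_add)
  qed
  ultimately show "c_linear \<alpha> m \<and> c_free l \<or> c_free m \<and> c_linear \<alpha> l"
    unfolding c_linear_def c_free_def by cases metis+
qed (auto simp: c_linear_def c_free_def lookup_add)

lemma c_linear_not_c_free: "c_linear \<alpha> m \<Longrightarrow> \<not> c_free m"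
  by (auto simp: c_linear_def c_free_def)

lemma c_linear_split:
  assumes "c_linear \<alpha> m"
  obtains m' where "m = Poly_Mapping.single (Cvar \<alpha>) 1 + m'"
proof
  show "m = Poly_Mapping.single (Cvar \<alpha>) 1 + (m - Poly_Mapping.single (Cvar \<alpha>) 1)"
    using assms
    by (intro poly_mapping_eqI)
      (auto simp: lookup_add lookup_single minus_poly_mapping.rep_eq when_def c_linear_def)
qed

lemma c_free_part_mult: "c_free_part (p * q) = c_free_part p * c_free_part q"
proof (rule additive_eqI[of "\<lambda>p. c_free_part (p * q)" "\<lambda>p. c_free_part p * c_free_part q"])
  fix m a
  show "c_free_part (Poly_Mapping.single m a * q) = c_free_part (Poly_Mapping.single m a) * c_free_part q"
    by (rule additive_eqI[of "\<lambda>q. c_free_part (Poly_Mapping.single m a * q)"])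
      (auto simp: distrib_left c_free_part_add c_free_part_single mult_single c_free_add)
qed (auto simp: distrib_right c_free_part_add)

text \<open>
  The map \<^term>\<open>c_coeff \<alpha>\<close> is a derivation over the ring homomorphism \<^term>\<open>c_free_part\<close>, which
  sets all \<open>c\<^sub>\<beta>\<close> to zero.
\<close>
lemma c_coeff_mult:
  "c_coeff \<alpha> (p * q) = c_coeff \<alpha> p * c_free_part q + c_free_part p * c_coeff \<alpha> q"
proof (rule additive_eqI[of "\<lambda>p. c_coeff \<alpha> (p * q)"
      "\<lambda>p. c_coeff \<alpha> p * c_free_part q + c_free_part p * c_coeff \<alpha> q"])
  fix m a
  show "c_coeff \<alpha> (Poly_Mapping.single m a * q) =
    c_coeff \<alpha> (Poly_Mapping.single m a) * c_free_part q +
    c_free_part (Poly_Mapping.single m a) * c_coeff \<alpha> q"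
  proof (rule additive_eqI[of "\<lambda>q. c_coeff \<alpha> (Poly_Mapping.single m a * q)"])
    fix l b
    consider "c_linear \<alpha> m" "c_free l" | "c_free m" "c_linear \<alpha> l" | "\<not> c_linear \<alpha> (m + l)"
      by (auto simp: c_linear_add)
    then show "c_coeff \<alpha> (Poly_Mapping.single m a * Poly_Mapping.single l b) =
      c_coeff \<alpha> (Poly_Mapping.single m a) * c_free_part (Poly_Mapping.single l b) +
      c_free_part (Poly_Mapping.single m a) * c_coeff \<alpha> (Poly_Mapping.single l b)"
    proof cases
      case 1
      from 1(1) obtain m' where m': "m = Poly_Mapping.single (Cvar \<alpha>) 1 + m'" by (rule c_linear_split)
      have "c_linear \<alpha> (m + l)" "\<not> c_free m" "\<not> c_linear \<alpha> l"
        using 1 by (auto simp: c_linear_add dest: c_linear_not_c_free)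
      moreover have "m + l - Poly_Mapping.single (Cvar \<alpha>) 1 = m' + l"
        unfolding m' by (simp add: add.assoc)
      ultimately show ?thesis using 1 m'
        by (simp add: mult_single c_coeff_single c_free_part_single)
    next
      case 2
      from 2(2) obtain l' where l': "l = Poly_Mapping.single (Cvar \<alpha>) 1 + l'" by (rule c_linear_split)
      have "c_linear \<alpha> (m + l)" "\<not> c_free l" "\<not> c_linear \<alpha> m"
        using 2 by (auto simp: c_linear_add dest: c_linear_not_c_free)
      moreover have "m + l - Poly_Mapping.single (Cvar \<alpha>) 1 = m + l'"
        unfolding l' by (metis add.left_commute add_diff_cancel_left')
      ultimately show ?thesis using 2 l'
        by (simp add: mult_single c_coeff_single c_free_part_single)
    next
      case 3
      then show ?thesis
        by (auto simp: mult_single c_coeff_single c_free_part_single c_linear_add)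
    qed
  qed (auto simp: distrib_left c_coeff_add c_free_part_add)
qed (auto simp: distrib_right c_coeff_add c_free_part_add algebra_simps)

interpretation c_free_part: comm_ring_hom "c_free_part :: 'k::field cpoly \<Rightarrow> 'k cpoly"
proof
  show "c_free_part (1 :: 'k cpoly) = 1"
    using c_free_part_single[of 0 "1 :: 'k"] by (simp add: c_free_def)
qed (auto simp: c_free_part_add c_free_part_mult c_free_part_0)

lemma c_coeff_zero [simp]: "c_coeff \<alpha> 0 = 0"
  by (simp add: c_coeff_def)

lemma c_coeff_sum: "c_coeff \<alpha> (sum f A) = (\<Sum>x\<in>A. c_coeff \<alpha> (f x))"
  by (induction A rule: infinite_finite_induct) (auto simp: c_coeff_add)

lemma c_free_part_const [simp]: "c_free_part (Poly_Mapping.single 0 a) = Poly_Mapping.single 0 a"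
  by (simp add: c_free_part_single c_free_def)

lemma c_coeff_const [simp]: "c_coeff \<alpha> (Poly_Mapping.single 0 a) = 0"
  by (simp add: c_coeff_single c_linear_def) 

lemma c_free_part_Xvar [simp]: "c_free_part (var (Xvar i)) = var (Xvar i)"
  by (simp add: c_free_part_single c_free_def var_def lookup_single)

lemma c_coeff_Xvar [simp]: "c_coeff \<alpha> (var (Xvar i)) = 0"
  by (simp add: c_coeff_single c_linear_def var_def lookup_single)

lemma c_free_part_Cvar [simp]: "c_free_part (var (Cvar \<alpha>)) = 0"
  using lookup_single_eq[of "Cvar \<alpha>" "1::nat"]
  unfolding var_def c_free_part_single c_free_def by (metis zero_neq_one)

lemma c_coeff_Cvar [simp]: "c_coeff \<alpha> (var (Cvar \<beta>)) = (if \<alpha> = \<beta> then 1 else 0)"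
  by (auto simp: c_coeff_single c_linear_def var_def lookup_single when_def)

lemma c_free_part_x_monom [simp]: "c_free_part (x_monom n \<alpha>) = x_monom n \<alpha>"
  by (simp add: x_monom_def c_free_part.hom_prod c_free_part.hom_power)

lemma c_coeff_generic_poly:
  assumes "\<alpha> \<in> multi_indices n d"
  shows "c_coeff \<alpha> (generic_poly n d) = x_monom n \<alpha>"
  using assms
  by (simp add: generic_poly_def c_coeff_sum c_coeff_mult finite_multi_indices
      if_distrib[of "\<lambda>x. x * _"] cong: if_cong)

text \<open>The exponent vectors of the \<open>n + 1\<close> monomials \<open>1, x\<^sub>1, \<dots>, x\<^sub>n\<close>.\<close>
definition affine_monomials :: "nat \<Rightarrow> (pvar \<Rightarrow>\<^sub>0 nat) set" where
  "affine_monomials n = insert 0 ((\<lambda>i. Poly_Mapping.single (Xvar i) 1) ` {..<n})"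

lemma keys_var: "Poly_Mapping.keys (var v :: 'k::field cpoly) = {Poly_Mapping.single v 1}"
  by (simp add: var_def)

lemma keys_scale_subset:
  "Poly_Mapping.keys (Poly_Mapping.single 0 a * p) \<subseteq> Poly_Mapping.keys (p :: 'k::field cpoly)"
  using keys_mult[of "Poly_Mapping.single 0 a" p] by (auto split: if_splits)

lemma keys_c_parts_allowed:
  assumes "p \<in> cpoly.span (allowed_monomials n d)"
  shows "Poly_Mapping.keys (c_free_part p) \<subseteq> affine_monomials n \<and>
    Poly_Mapping.keys (c_coeff \<alpha> p) \<subseteq> affine_monomials n"
  using assms
proof (induction rule: cpoly.span_induct_alt)
  case base
  show ?case by simp
next
  case (step a p q)
  have "Poly_Mapping.keys (c_free_part p) \<subseteq> affine_monomials n \<and>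
    Poly_Mapping.keys (c_coeff \<alpha> p) \<subseteq> affine_monomials n"
    using step(1) unfolding allowed_monomials_def
    by (auto simp: c_coeff_mult c_free_part_mult keys_var affine_monomials_def split: if_splits
        simp flip: single_one)
  with step(2) show ?case
    unfolding c_coeff_mult c_free_part_mult c_coeff_add c_free_part_add c_free_part_const
      c_coeff_const mult_zero_left add_0_left
    using keys_add[of "Poly_Mapping.single 0 a * c_free_part p" "c_free_part q"]
      keys_add[of "Poly_Mapping.single 0 a * c_coeff \<alpha> p" "c_coeff \<alpha> q"]
      keys_scale_subset[of a "c_free_part p"] keys_scale_subset[of a "c_coeff \<alpha> p"]
    by blast
qed

lemma card_affine_monomials: "card (affine_monomials n) = n + 1" "finite (affine_monomials n)"
proof -
  show fin: "finite (affine_monomials n)" by (simp add: affine_monomials_def)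
  have "inj_on (\<lambda>i. Poly_Mapping.single (Xvar i) (1::nat)) {..<n}"
    by (rule inj_onI) (auto dest: arg_cong[of _ _ Poly_Mapping.keys])
  moreover have "0 \<notin> (\<lambda>i. Poly_Mapping.single (Xvar i) (1::nat)) ` {..<n}"
    by (auto dest: arg_cong[of _ _ Poly_Mapping.keys])
  ultimately show "card (affine_monomials n) = n + 1"
    by (simp add: affine_monomials_def card_image)
qed

section \<open>Homogeneous linear systems, cofactors and monomials\<close>

text \<open>
  A homogeneous linear system with unknowns indexed by \<open>I\<close> and fewer equations, indexed by \<open>X\<close>.
\<close>
lemma homogeneous_system_nontrivial_solution:
  fixes f :: "'i \<Rightarrow> 'x \<Rightarrow> 'k::field"
  assumes "finite X" "finite I" "card X < card I"
  shows "\<exists>a. (\<exists>i\<in>I. a i \<noteq> 0) \<and> (\<forall>x\<in>X. (\<Sum>i\<in>I. a i * f i x) = 0)"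
  using assms
proof (induction X arbitrary: I f rule: finite_induct)
  case empty
  then show ?case by (intro exI[of _ "\<lambda>_. 1"]) (auto simp: card_gt_0_iff)
next
  case (insert x X)
  show ?case
  proof (cases "\<forall>i\<in>I. f i x = 0")
    case True
    have "card X < card I" using insert by simp
    from insert.IH[OF insert.prems(1) this, of f] True show ?thesis by auto
  next
    case False
    then obtain k where k: "k \<in> I" "f k x \<noteq> 0" by auto
    \<comment> \<open>The equation \<open>x\<close> is solved for the unknown \<open>k\<close>, which is eliminated from the others.\<close>
    define J where "J = I - {k}"
    have J: "finite J" "card X < card J" "k \<notin> J" "I = insert k J"
      using insert k by (auto simp: J_def)
    obtain a where a: "\<exists>i\<in>J. a i \<noteq> 0"
      "\<And>y. y \<in> X \<Longrightarrow> (\<Sum>i\<in>J. a i * (f i y - f i x / f k x * f k y)) = 0"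
      using insert.IH[OF J(1,2), of "\<lambda>i y. f i y - f i x / f k x * f k y"] by blast
    define b where "b = a(k := - (\<Sum>i\<in>J. a i * f i x) / f k x)"
    have sum_b: "(\<Sum>i\<in>I. b i * f i y) = (\<Sum>i\<in>J. a i * (f i y - f i x / f k x * f k y))" for y
    proof -
      have "(\<Sum>i\<in>I. b i * f i y) = b k * f k y + (\<Sum>i\<in>J. b i * f i y)"
        using J by simp
      also have "(\<Sum>i\<in>J. b i * f i y) = (\<Sum>i\<in>J. a i * f i y)"
        using J by (intro sum.cong) (auto simp: b_def)
      also have "b k * f k y = - (\<Sum>i\<in>J. a i * (f i x / f k x * f k y))"
        by (simp add: b_def sum_distrib_right sum_divide_distrib mult.assoc)
      finally show ?thesis by (simp add: right_diff_distrib sum_subtractf)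
    qed
    have "\<exists>i\<in>I. b i \<noteq> 0" using a(1) J by (auto simp: b_def)
    moreover have "(\<Sum>i\<in>I. b i * f i y) = 0" if "y \<in> insert x X" for y
      using that a(2) k by (auto simp: sum_b)
    ultimately show ?thesis by blast
  qed
qed

lemma cofactor_expansion:
  fixes A :: "'a::comm_ring_1 mat"
  assumes A: "A \<in> carrier_mat N N" and "i < N" "k < N"
  shows "(\<Sum>j<N. A $$ (i, j) * cofactor A k j) = (if i = k then det A else 0)"
proof -
  have "(A * adj_mat A) $$ (i, k) = (det A \<cdot>\<^sub>m 1\<^sub>m N) $$ (i, k)"
    using adj_mat(2)[OF A] by simp
  then show ?thesis
    using assms by (simp add: adj_mat_def scalar_prod_def atLeast0LessThan)
qed

lemma cofactor_cong_other_rows: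
  assumes "A \<in> carrier_mat N N" "B \<in> carrier_mat N N"
    and "\<And>i j. i < N \<Longrightarrow> j < N \<Longrightarrow> i \<noteq> k \<Longrightarrow> A $$ (i, j) = B $$ (i, j)"
  shows "cofactor A k j = cofactor B k j"
proof -
  have "mat_delete A k j = mat_delete B k j"
    using assms by (intro eq_matI) (auto simp: mat_delete_def)
  then show ?thesis by (simp add: cofactor_def)
qed

lemma cofactor_c_free_part:
  "cofactor (map_mat c_free_part M) k j = c_free_part (cofactor M k j)"
proof -
  have "mat_delete (map_mat c_free_part M) k j = map_mat c_free_part (mat_delete M k j)"
    by (intro eq_matI) (auto simp: mat_delete_def)
  then show ?thesis
    by (simp add: cofactor_def c_free_part.hom_mult c_free_part.hom_power
        c_free_part.hom_uminus c_free_part.hom_det)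
qed

lemma lookup_scale:
  "Poly_Mapping.lookup (Poly_Mapping.single 0 a * p) m =
    a * Poly_Mapping.lookup (p :: 'k::field cpoly) m"
  by (simp add: map.rep_eq when_def flip: mult_map_scale_conv_mult)

lemma scale_eq_0_iff:
  "Poly_Mapping.single 0 a * Poly_Mapping.single 0 b = (0 :: 'k::field cpoly) \<longleftrightarrow> a = 0 \<or> b = 0"
  by (simp add: mult_single flip: keys_eq_empty) 

text \<open>The exponent vector of \<open>x\<^sup>\<alpha>\<close> in the polynomial ring in all variables \<open>x\<^sub>i\<close> and \<open>c\<^sub>\<beta>\<close>.\<close>
definition x_exponent :: "nat \<Rightarrow> multi_index \<Rightarrow> (pvar \<Rightarrow>\<^sub>0 nat)" where
  "x_exponent n \<alpha> = (\<Sum>i<n. Poly_Mapping.single (Xvar i) (Poly_Mapping.lookup \<alpha> i))"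

lemma var_power: "var v ^ k = Poly_Mapping.single (Poly_Mapping.single v k) 1"
proof (induction k)
  case (Suc k)
  have "Poly_Mapping.single v 1 + Poly_Mapping.single v k = Poly_Mapping.single v (Suc k)"
    by (simp flip: single_add)
  then show ?case using Suc by (simp add: var_def mult_single)
qed simp

lemma prod_single_1:
  "(\<Prod>x\<in>A. Poly_Mapping.single (g x) (1::'k::comm_semiring_1)) = Poly_Mapping.single (\<Sum>x\<in>A. g x) 1"
  by (induction A rule: infinite_finite_induct) (auto simp: mult_single)

lemma x_monom_eq_single: "x_monom n \<alpha> = Poly_Mapping.single (x_exponent n \<alpha>) 1"
  by (simp add: x_monom_def x_exponent_def var_power prod_single_1)

lemma lookup_x_exponent:
  "Poly_Mapping.lookup (x_exponent n \<alpha>) (Xvar i) = (if i < n then Poly_Mapping.lookup \<alpha> i else 0)"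
  by (simp add: x_exponent_def lookup_sum lookup_single when_def)

lemma inj_on_x_exponent: "inj_on (x_exponent n) (multi_indices n d)"
proof (rule inj_onI)
  fix \<alpha> \<beta> assume *: "\<alpha> \<in> multi_indices n d" "\<beta> \<in> multi_indices n d" "x_exponent n \<alpha> = x_exponent n \<beta>"
  show "\<alpha> = \<beta>"
  proof (rule poly_mapping_eqI)
    fix i
    show "Poly_Mapping.lookup \<alpha> i = Poly_Mapping.lookup \<beta> i"
    proof (cases "i < n")
      case True
      then show ?thesis
        using arg_cong[OF *(3), of "\<lambda>m. Poly_Mapping.lookup m (Xvar i)"] by (simp add: lookup_x_exponent)
    next
      case False
      then have "i \<notin> Poly_Mapping.keys \<alpha>" "i \<notin> Poly_Mapping.keys \<beta>"
        using * by (auto simp: multi_indices_def)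
      then show ?thesis by (simp add: in_keys_iff)
    qed
  qed
qed

lemma x_monoms_independent:
  assumes "(\<Sum>\<alpha>\<in>multi_indices n d. Poly_Mapping.single 0 (b \<alpha>) * x_monom n \<alpha>) = (0 :: 'k::field cpoly)"
    and "\<beta> \<in> multi_indices n d"
  shows "b \<beta> = 0"
proof -
  have "0 = Poly_Mapping.lookup (\<Sum>\<alpha>\<in>multi_indices n d. Poly_Mapping.single 0 (b \<alpha>) * x_monom n \<alpha>) (x_exponent n \<beta>)"
    using assms by simp
  also have "\<dots> = (\<Sum>\<alpha>\<in>multi_indices n d. if \<alpha> = \<beta> then b \<alpha> else 0)"
    unfolding lookup_sum using assms(2) inj_on_x_exponent[of n d]
    by (intro sum.cong) (auto simp: lookup_scale x_monom_eq_single lookup_single when_def inj_on_def)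
  also have "\<dots> = b \<beta>"
    using assms(2) by (simp add: finite_multi_indices)
  finally show ?thesis by simp
qed

lemma zero_in_multi_indices: "0 \<in> multi_indices n d"
  by (simp add: multi_indices_def)

lemma x_monom_0 [simp]: "x_monom n 0 = 1"
  by (simp add: x_monom_def)

section \<open>The dimension count\<close>

text \<open>
  The vector \<open>u\<close> spans a witness: \<open>u\<^sup>T M\<^sub>0 = 0\<close>. The rows of \<open>M\<^sub>0\<close> other than the row \<open>k\<close>, where
  \<open>u\<^sub>k \<noteq> 0\<close>, and the coefficient rows \<open>s\<^sub>\<alpha>\<close> of \<open>c\<^sub>\<alpha>\<close> in \<open>u\<^sup>T M\<close> are linearly independent elements
  of the \<open>N (n + 1)\<close>-dimensional space of rows of affine-linear forms in \<open>x\<close>.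
\<close>
lemma left_kernel_card_bound:
  fixes M :: "'k::field cpoly mat" and u :: "nat \<Rightarrow> 'k"
  assumes rep: "uniform_det_rep n d N M" and k: "k < N" "u k \<noteq> 0"
    and ker: "\<And>j. j < N \<Longrightarrow> c_free_part (\<Sum>i<N. Poly_Mapping.single 0 (u i) * M $$ (i, j)) = 0"
  shows "card (multi_indices n d) + (N - 1) \<le> N * (n + 1)"
proof (rule ccontr)
  let ?K = "Poly_Mapping.single 0 :: 'k \<Rightarrow> 'k cpoly"
  define M0 where "M0 = map_mat c_free_part M"
  have M: "M \<in> carrier_mat N N" "det M = generic_poly n d"
    and M_span: "\<And>i j. i < N \<Longrightarrow> j < N \<Longrightarrow> M $$ (i, j) \<in> cpoly.span (allowed_monomials n d)"
    using rep by (auto simp: uniform_det_rep_def)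
  have M0: "M0 \<in> carrier_mat N N" using M by (simp add: M0_def)
  \<comment> \<open>The cofactors along row \<open>k\<close> satisfy a linear relation for each other row of \<open>M\<^sub>0\<close>.\<close>
  define C where "C j = cofactor M0 k j" for j
  define w where "w j = (\<Sum>i<N. ?K (u i) * M $$ (i, j))" for j
  define s where "s \<alpha> j = c_coeff \<alpha> (w j)" for \<alpha> j

  have r_rel: "(\<Sum>j<N. M0 $$ (i, j) * C j) = 0" if "i < N" "i \<noteq> k" for i
    using cofactor_expansion[OF M0 that(1) k(1)] that by (simp add: C_def)

  have s_rel: "(\<Sum>j<N. s \<alpha> j * C j) = ?K (u k) * x_monom n \<alpha>" if "\<alpha> \<in> multi_indices n d" for \<alpha>
  proof -
    \<comment> \<open>Replacing row \<open>k\<close> of \<open>M\<close> by the row \<open>w = u\<^sup>T M\<close> multiplies the determinant by \<open>u\<^sub>k\<close>.\<close>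
    have "(\<Sum>j<N. w j * cofactor M k j) = (\<Sum>i<N. ?K (u i) * (\<Sum>j<N. M $$ (i, j) * cofactor M k j))"
      unfolding w_def sum_distrib_left sum_distrib_right by (subst sum.swap) (simp add: mult.assoc)
    also have "\<dots> = (\<Sum>i<N. if i = k then ?K (u i) * det M else 0)"
      by (intro sum.cong) (auto simp: cofactor_expansion[OF M(1) _ k(1)])
    also have "\<dots> = ?K (u k) * generic_poly n d" using k M by simp
    \<comment> \<open>As \<open>w\<close> vanishes at \<open>c = 0\<close>, the product rule leaves only the terms \<open>s\<^sub>\<alpha> C\<close>.\<close>
    finally have "c_coeff \<alpha> (\<Sum>j<N. w j * cofactor M k j) = ?K (u k) * x_monom n \<alpha>"
      using that by (simp add: c_coeff_mult c_coeff_generic_poly)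
    also have "c_coeff \<alpha> (\<Sum>j<N. w j * cofactor M k j) = (\<Sum>j<N. s \<alpha> j * C j)"
      unfolding c_coeff_sum
      by (intro sum.cong)
        (auto simp: c_coeff_mult s_def C_def M0_def cofactor_c_free_part ker[folded w_def])
    finally show ?thesis .
  qed

  have rows_independent: "a i = 0"
    if a: "\<And>j. j < N \<Longrightarrow> (\<Sum>i\<in>{..<N} - {k}. ?K (a i) * M0 $$ (i, j)) = 0" and i: "i < N" "i \<noteq> k" for a i
  proof -
    \<comment> \<open>Row \<open>k\<close> of \<open>M\<^sub>0\<close> is replaced by \<open>s\<^sub>0\<close>. The determinant becomes \<open>u\<^sub>k x\<^sup>0\<close>, a nonzero constant, so
      the rows of the new matrix are independent.\<close>
    define B where "B = mat N N (\<lambda>(i, j). if i = k then s 0 j else M0 $$ (i, j))"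
    have B: "B \<in> carrier_mat N N" by (simp add: B_def)
    have "cofactor B k j = C j" for j
      unfolding C_def by (rule cofactor_cong_other_rows[OF B M0]) (auto simp: B_def)
    then have det_B: "det B = ?K (u k)"
      using laplace_expansion_row[OF B k(1)] s_rel[OF zero_in_multi_indices] k(1)
      by (simp add: B_def)
    have "0 = (\<Sum>j<N. (\<Sum>l\<in>{..<N} - {k}. ?K (a l) * M0 $$ (l, j)) * cofactor B i j)"
      using a by simp
    also have "\<dots> = (\<Sum>l\<in>{..<N} - {k}. ?K (a l) * (\<Sum>j<N. B $$ (l, j) * cofactor B i j))"
      unfolding sum_distrib_left sum_distrib_right
      by (subst sum.swap) (auto simp: mult.assoc B_def intro!: sum.cong)
    also have "\<dots> = (\<Sum>l\<in>{..<N} - {k}. if l = i then ?K (a l) * det B else 0)"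
      by (intro sum.cong) (auto simp: cofactor_expansion[OF B _ i(1)])
    also have "\<dots> = ?K (a i) * ?K (u k)" using i by (simp add: det_B)
    finally have "?K (a i) * ?K (u k) = 0" by (rule sym)
    then show "a i = 0" using k unfolding scale_eq_0_iff by simp
  qed

  let ?R = "{..<N} - {k}" and ?A = "multi_indices n d"
  define I where "I = ?R <+> ?A"
  define X where "X = {..<N} \<times> affine_monomials n"
  define row where "row = (\<lambda>t j. case t of Inl i \<Rightarrow> M0 $$ (i, j) | Inr \<alpha> \<Rightarrow> s \<alpha> j)"
  assume "\<not> card ?A + (N - 1) \<le> N * (n + 1)"
  then have "card X < card I"
    using k by (simp add: X_def I_def card_Plus finite_multi_indices card_affine_monomials)
  moreover have "finite X" "finite I"
    by (simp_all add: X_def I_def card_affine_monomials finite_multi_indices)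
  ultimately obtain a where a: "\<exists>t\<in>I. a t \<noteq> 0"
    "\<And>x. x \<in> X \<Longrightarrow> (\<Sum>t\<in>I. a t * (case x of (j, m) \<Rightarrow> Poly_Mapping.lookup (row t j) m)) = 0"
    using homogeneous_system_nontrivial_solution[of X I "\<lambda>t (j, m). Poly_Mapping.lookup (row t j) m"]
    by blast
  have w_span: "w j \<in> cpoly.span (allowed_monomials n d)" if "j < N" for j
    unfolding w_def using M_span that by (auto intro!: cpoly.span_sum cpoly.span_scale)
  have row_keys: "Poly_Mapping.keys (row t j) \<subseteq> affine_monomials n" if "t \<in> I" "j < N" for t j
  proof (cases t)
    case (Inl i)
    then have "i < N" using that by (auto simp: I_def)
    then show ?thesis
      using keys_c_parts_allowed[OF M_span, of i j] that M by (simp add: row_def Inl M0_def)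
  next
    case (Inr \<alpha>)
    then show ?thesis using keys_c_parts_allowed[OF w_span] that by (simp add: row_def s_def)
  qed
  have row_sum: "(\<Sum>t\<in>I. ?K (a t) * row t j) = 0" if j: "j < N" for j
  proof (rule poly_mapping_eqI)
    fix m
    show "Poly_Mapping.lookup (\<Sum>t\<in>I. ?K (a t) * row t j) m = Poly_Mapping.lookup 0 m"
    proof (cases "m \<in> affine_monomials n")
      case True
      then show ?thesis using a(2)[of "(j, m)"] j by (simp add: lookup_sum lookup_scale X_def)
    next
      case False
      then have "Poly_Mapping.lookup (row t j) m = 0" if "t \<in> I" for t
        using row_keys[OF that j] by (auto simp: in_keys_iff)
      then show ?thesis by (simp add: lookup_sum lookup_scale)
    qed
  qed
  have row_sum': "(\<Sum>i\<in>?R. ?K (a (Inl i)) * M0 $$ (i, j)) + (\<Sum>\<alpha>\<in>?A. ?K (a (Inr \<alpha>)) * s \<alpha> j) = 0"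
    if "j < N" for j
    using row_sum[OF that] by (simp add: I_def sum.Plus finite_multi_indices row_def)

  \<comment> \<open>Pairing the relation with the cofactors kills the rows of \<open>M\<^sub>0\<close> and turns each \<open>s\<^sub>\<alpha>\<close> into
    \<open>u\<^sub>k x\<^sup>\<alpha>\<close>.\<close>
  have "0 = (\<Sum>j<N. (\<Sum>t\<in>I. ?K (a t) * row t j) * C j)"
    using row_sum by simp
  also have "\<dots> = (\<Sum>t\<in>I. ?K (a t) * (\<Sum>j<N. row t j * C j))"
    unfolding sum_distrib_left sum_distrib_right by (subst sum.swap) (simp add: mult.assoc)
  also have "\<dots> = (\<Sum>\<alpha>\<in>?A. ?K (a (Inr \<alpha>) * u k) * x_monom n \<alpha>)"
    unfolding I_def
    by (subst sum.Plus) (auto simp: finite_multi_indices row_def r_rel s_rel mult.assoc[symmetric]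
        mult_single)
  finally have "(\<Sum>\<alpha>\<in>?A. ?K (a (Inr \<alpha>) * u k) * x_monom n \<alpha>) = 0" by (rule sym)
  then have "a (Inr \<alpha>) * u k = 0" if "\<alpha> \<in> ?A" for \<alpha>
    using that by (rule x_monoms_independent)
  then have Inr_0: "a (Inr \<alpha>) = 0" if "\<alpha> \<in> ?A" for \<alpha>
    using that k by auto
  then have Inl_rel: "(\<Sum>i\<in>?R. ?K (a (Inl i)) * M0 $$ (i, j)) = 0" if "j < N" for j
    using row_sum'[OF that] by simp
  have "a (Inl i) = 0" if "i \<in> ?R" for i
    by (rule rows_independent[where a = "\<lambda>i. a (Inl i)", OF Inl_rel]) (use that in auto)
  with Inr_0 a(1) show False by (auto simp: I_def)
qed

section \<open>One-dimensional witnesses\<close>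

text \<open>
  The dimension of a space without a finite generating set is unspecified, so it has to be shown
  that a subspace of a finite-dimensional space has a finite basis.
\<close>
lemma (in vectorspace) subspace_dim_0:
  assumes "fin_dim" "subspace K W V" "vectorspace.dim K (vs W) = 0"
  shows "W = {\<zero>\<^bsub>V\<^esub>}"
proof -
  interpret W: vectorspace K "vs W" using assms(2) by (rule subspace_is_vs)
  have W: "submodule K W V" using assms(2) by simp
  then have "W \<subseteq> carrier V" by (simp add: submodule_def)
  have zero: "\<zero>\<^bsub>vs W\<^esub> = \<zero>\<^bsub>V\<^esub>" by simp
  have "finite S \<and> card S \<le> dim" if "S \<subseteq> carrier (vs W) \<and> W.lin_indpt S" for S
    using that span_li_not_depend(2)[OF _ W, of S] li_le_dim[OF assms(1), of S] \<open>W \<subseteq> carrier V\<close> by auto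
  moreover have "{} \<subseteq> carrier (vs W) \<and> W.lin_indpt {}" by (auto simp: W.lin_dep_def)
  ultimately have "\<exists>S. finite S \<and> maximal S (\<lambda>S. S \<subseteq> carrier (vs W) \<and> W.lin_indpt S)"
    by (rule maximal_exists)
  then obtain S where S: "finite S" "maximal S (\<lambda>S. S \<subseteq> carrier (vs W) \<and> W.lin_indpt S)" by blast
  from S(2) have basis: "W.basis S" by (rule W.max_li_is_basis)
  then have "card S = 0" using W.dim_basis[OF S(1)] assms(3) by simp
  then have "W.span {} = carrier (vs W)" using basis S(1) by (simp add: W.basis_def)
  then show ?thesis using W.span_empty by simp
qed

lemma (in vectorspace) zero_subspace_dim:
  shows "subspace K {\<zero>\<^bsub>V\<^esub>} V" "vectorspace.dim K (vs {\<zero>\<^bsub>V\<^esub>}) = 0"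
proof -
  show sub: "subspace K {\<zero>\<^bsub>V\<^esub>} V"
    using span_is_subspace[of "{}"] span_empty by simp
  interpret W: vectorspace K "vs {\<zero>\<^bsub>V\<^esub>}" using sub by (rule subspace_is_vs)
  have "W.span {\<zero>\<^bsub>V\<^esub>} = {\<zero>\<^bsub>V\<^esub>}"
    using W.span_is_subset2[of "{\<zero>\<^bsub>V\<^esub>}"] W.in_own_span[of "{\<zero>\<^bsub>V\<^esub>}"] by auto
  then show "W.dim = 0" using W.dim0I by simp
qed

lemma (in vectorspace) span_singleton_dim:
  assumes "v \<in> carrier V" "v \<noteq> \<zero>\<^bsub>V\<^esub>"
  shows "vectorspace.dim K (vs (span {v})) = 1"
proof -
  have sub: "subspace K (span {v}) V" using assms by (intro span_is_subspace) auto
  interpret W: vectorspace K "vs (span {v})" using sub by (rule subspace_is_vs)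
  have "{v} \<subseteq> span {v}" using assms by (intro in_own_span) auto
  moreover from this have "W.span {v} = span {v}" using sub by (intro span_li_not_depend(1)) auto
  ultimately show ?thesis using assms by (intro W.dim1I[of v]) auto
qed

lemma vec_space_fin_dim: "vectorspace.fin_dim class_ring (module_vec TYPE('k::field) N)"
  by (rule vec_space.fin_dim)

lemma compression_witness_dim_1_obtains:
  fixes \<A> :: "'k::field mat set"
  assumes \<A>: "\<A> \<subseteq> carrier_mat N N" and U: "compression_witness N \<A> U" "vec_dim N U = 1"
  obtains u where "u \<in> carrier_vec N" "u \<noteq> 0\<^sub>v N" "\<And>A. A \<in> \<A> \<Longrightarrow> transpose_mat A *\<^sub>v u = 0\<^sub>v N"
proof -
  interpret V: vectorspace class_ring "module_vec TYPE('k) N" by (rule vec_vs)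
  have U_sub: "VectorSpace.subspace class_ring U (module_vec TYPE('k) N)"
    and "vec_dim N (row_image N \<A> U) = 0"
    using U by (auto simp: compression_witness_def)
  have U_carrier: "U \<subseteq> carrier_vec N"
    using V.is_module[OF U_sub] by (simp add: submodule_def module_vec_simps)
  define G where "G = {transpose_mat A *\<^sub>v u | A u. A \<in> \<A> \<and> u \<in> U}"
  have G: "G \<subseteq> carrier (module_vec TYPE('k) N)"
    using \<A> U_carrier by (force simp: G_def module_vec_simps)
  have "V.span G = {0\<^sub>v N}"
    using V.subspace_dim_0[OF vec_space_fin_dim V.span_is_subspace[OF G]] \<open>vec_dim N (row_image N \<A> U) = 0\<close>
    by (simp add: vec_dim_def row_image_def G_def module_vec_simps)
  then have G_0: "G \<subseteq> {0\<^sub>v N}" using V.in_own_span[OF G] by simp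
  have "U \<noteq> {0\<^sub>v N}"
    using U(2) V.zero_subspace_dim(2) by (auto simp: vec_dim_def module_vec_simps)
  moreover have "0\<^sub>v N \<in> U"
    using V.is_module[OF U_sub] by (simp add: submodule_def module_vec_simps)
  ultimately obtain u where "u \<in> U" "u \<noteq> 0\<^sub>v N" by blast
  with G_0 U_carrier show thesis by (intro that[of u]) (auto simp: G_def)
qed

lemma matrix_space_generators:
  assumes "A \<in> carrier_mat N N"
  shows "insert (coeff_mat 0 A) {coeff_mat (Poly_Mapping.single (Xvar i) 1) A | i. i < n}
    \<subseteq> carrier (module_mat TYPE('k::field) N N)"
  using assms by (auto simp: coeff_mat_def module_mat_simps)

lemma matrix_space_carrier:
  assumes "A \<in> carrier_mat N N"
  shows "matrix_space n N (A :: 'k::field cpoly mat) \<subseteq> carrier_mat N N"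
proof -
  interpret V: vectorspace class_ring "module_mat TYPE('k) N N" by (rule matrix_vs)
  show ?thesis
    using V.span_is_subset2[OF matrix_space_generators[OF assms]]
    by (simp add: matrix_space_def module_mat_simps)
qed

lemma coeff_mat_in_matrix_space:
  assumes "A \<in> carrier_mat N N" "m \<in> affine_monomials n"
  shows "coeff_mat m (A :: 'k::field cpoly mat) \<in> matrix_space n N A"
proof -
  interpret V: vectorspace class_ring "module_mat TYPE('k) N N" by (rule matrix_vs)
  show ?thesis
    using V.in_own_span[OF matrix_space_generators[OF assms(1), of n]] assms(2)
    by (auto simp: matrix_space_def affine_monomials_def)
qed

text \<open>
  A one-dimensional witness has image of dimension \<open>0\<close>, so any nonzero vector in it annihilates
  \<open>M\<^sub>0\<close> from the left.
\<close>
lemma one_dim_witness_card_bound: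
  fixes M :: "'k::field cpoly mat"
  assumes rep: "uniform_det_rep n d N M"
    and U: "compression_witness N (matrix_space n N (M0_part M)) U" "vec_dim N U = 1"
  shows "card (multi_indices n d) \<le> n * N + 1"
proof -
  have M: "M \<in> carrier_mat N N"
    and M_span: "\<And>i j. i < N \<Longrightarrow> j < N \<Longrightarrow> M $$ (i, j) \<in> cpoly.span (allowed_monomials n d)"
    using rep by (auto simp: uniform_det_rep_def)
  then have M0: "M0_part M \<in> carrier_mat N N" by (simp add: M0_part_def)
  from compression_witness_dim_1_obtains[OF matrix_space_carrier[OF M0] U]
  obtain u where u: "u \<in> carrier_vec N" "u \<noteq> 0\<^sub>v N"
    and ker: "\<And>A. A \<in> matrix_space n N (M0_part M) \<Longrightarrow> transpose_mat A *\<^sub>v u = 0\<^sub>v N"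
    by blast
  obtain k where k: "k < N" "u $ k \<noteq> 0" using u by (metis carrier_vecD eq_vecI index_zero_vec)
  have "c_free_part (\<Sum>i<N. Poly_Mapping.single 0 (u $ i) * M $$ (i, j)) = 0" (is "c_free_part ?w = 0")
    if j: "j < N" for j
  proof (rule poly_mapping_eqI)
    fix m
    have w: "c_free_part ?w = (\<Sum>i<N. Poly_Mapping.single 0 (u $ i) * c_free_part (M $$ (i, j)))"
      by (simp add: c_free_part.hom_sum c_free_part_mult)
    show "Poly_Mapping.lookup (c_free_part ?w) m = Poly_Mapping.lookup 0 m"
    proof (cases "m \<in> affine_monomials n")
      case True
      have "(transpose_mat (coeff_mat m (M0_part M)) *\<^sub>v u) $ j = 0"
        using ker[OF coeff_mat_in_matrix_space[OF M0 True]] j by simp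
      then show ?thesis
        using j u(1) M unfolding w
        by (simp add: lookup_sum lookup_scale coeff_mat_def M0_part_def scalar_prod_def
            atLeast0LessThan mult.commute)
    next
      case False
      then have "Poly_Mapping.lookup (c_free_part (M $$ (i, j))) m = 0" if "i < N" for i
        using keys_c_parts_allowed[OF M_span[OF that j], THEN conjunct1] by (auto simp: in_keys_iff)
      then show ?thesis unfolding w by (simp add: lookup_sum lookup_scale)
    qed
  qed
  from left_kernel_card_bound[OF rep k this] show ?thesis
    using k(1) by (simp add: algebra_simps)
qed

lemma zero_row_witness:
  fixes A :: "'k::field cpoly mat" and n :: nat
  assumes A: "A \<in> carrier_mat N N" and N: "0 < N" and zero: "\<And>j. j < N \<Longrightarrow> A $$ (0, j) = 0"
  defines "\<A> \<equiv> matrix_space n N A"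
  shows "singular_space \<A>" "compression_space N \<A>"
    "\<exists>U. compression_witness N \<A> U \<and> vec_dim N U = 1"
proof -
  interpret V: vectorspace class_ring "module_vec TYPE('k) N" by (rule vec_vs)
  interpret W: vectorspace class_ring "module_mat TYPE('k) N N" by (rule matrix_vs)
  have "submodule class_ring {B \<in> carrier_mat N N. \<forall>j<N. B $$ (0, j) = (0 :: 'k)} (module_mat TYPE('k) N N)"
    using N W.module_axioms by (auto simp: submodule_def module_mat_simps)
  then have \<A>_row: "\<A> \<subseteq> {B \<in> carrier_mat N N. \<forall>j<N. B $$ (0, j) = 0}"
    unfolding \<A>_def matrix_space_def using A N zero
    by (intro W.span_is_subset) (auto simp: coeff_mat_def)
  show "singular_space \<A>"
    unfolding singular_space_def
  proof
    fix B assume "B \<in> \<A>"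
    then have B: "B \<in> carrier_mat N N" "\<And>j. j < N \<Longrightarrow> B $$ (0, j) = 0" using \<A>_row by auto
    show "det B = 0" using laplace_expansion_row[OF B(1) N] B(2) by simp
  qed
  have \<A>_sub: "VectorSpace.subspace class_ring \<A> (module_mat TYPE('k) N N)"
    unfolding \<A>_def matrix_space_def by (intro W.span_is_subspace matrix_space_generators A)
  define U where "U = V.span {unit_vec N 0}"
  have e: "unit_vec N 0 \<in> carrier (module_vec TYPE('k) N)" "unit_vec N 0 \<noteq> (0\<^sub>v N :: 'k vec)"
    using N by (auto simp: module_vec_simps dest: arg_cong[of _ _ "\<lambda>v. v $ 0"])
  have U_sub: "VectorSpace.subspace class_ring U (module_vec TYPE('k) N)"
    unfolding U_def using e by (intro V.span_is_subspace) auto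
  have "submodule class_ring {v \<in> carrier_vec N. \<forall>i<N. i \<noteq> 0 \<longrightarrow> v $ i = (0 :: 'k)} (module_vec TYPE('k) N)"
    using N V.module_axioms by (auto simp: submodule_def module_vec_simps)
  then have U_coords: "U \<subseteq> {v \<in> carrier_vec N. \<forall>i<N. i \<noteq> 0 \<longrightarrow> v $ i = 0}"
    unfolding U_def by (intro V.span_is_subset) auto
  have "transpose_mat B *\<^sub>v u = 0\<^sub>v N" if "B \<in> \<A>" "u \<in> U" for B u
  proof (intro eq_vecI)
    fix j assume "j < dim_vec (0\<^sub>v N :: 'k vec)"
    then have j: "j < N" by simp
    have B: "B \<in> carrier_mat N N" and u: "u \<in> carrier_vec N"
      using that \<A>_row U_coords by auto
    have "(transpose_mat B *\<^sub>v u) $ j = (\<Sum>i<N. B $$ (i, j) * u $ i)"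
      using B u j by (simp add: scalar_prod_def atLeast0LessThan)
    also have "\<dots> = 0"
    proof (intro sum.neutral ballI)
      fix i assume "i \<in> {..<N}"
      then show "B $$ (i, j) * u $ i = 0" using that j \<A>_row U_coords by (cases "i = 0") auto
    qed
    finally show "(transpose_mat B *\<^sub>v u) $ j = (0\<^sub>v N :: 'k vec) $ j" using j by simp
  qed (use that \<A>_row in auto)
  then have "row_image N \<A> U \<subseteq> {0\<^sub>v N}"
    unfolding row_image_def
    using V.zero_subspace_dim(1) by (intro V.span_is_subset) (auto simp: module_vec_simps)
  moreover have "0\<^sub>v N \<in> row_image N \<A> U"
  proof -
    have "{transpose_mat B *\<^sub>v u | B u. B \<in> \<A> \<and> u \<in> U} \<subseteq> carrier (module_vec TYPE('k) N)"
      using \<A>_row U_coords by (force simp: module_vec_simps)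
    from V.is_module[OF V.span_is_subspace[OF this]] show ?thesis
      unfolding row_image_def by (simp add: submodule_def module_vec_simps)
  qed
  ultimately have "row_image N \<A> U = {0\<^sub>v N}" by blast
  then have "vec_dim N (row_image N \<A> U) = 0"
    using V.zero_subspace_dim(2) by (simp add: vec_dim_def module_vec_simps)
  moreover have "vec_dim N U = 1"
    using V.span_singleton_dim[of "unit_vec N 0"] e by (simp add: vec_dim_def U_def module_vec_simps)
  ultimately show "compression_space N \<A>" "\<exists>U. compression_witness N \<A> U \<and> vec_dim N U = 1"
    using U_sub \<A>_sub unfolding compression_space_def compression_witness_def by auto
qed

section \<open>Representations from connected sets of monomials\<close>

lemma x_exponent_add: "x_exponent n (\<alpha> + \<beta>) = x_exponent n \<alpha> + x_exponent n \<beta>"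
  by (simp add: x_exponent_def lookup_add single_add sum.distrib)

lemma x_exponent_single:
  assumes "i < n"
  shows "x_exponent n (Poly_Mapping.single i k) = Poly_Mapping.single (Xvar i) k"
proof -
  have "x_exponent n (Poly_Mapping.single i k) =
      (\<Sum>j<n. if j = i then Poly_Mapping.single (Xvar i) k else 0)"
    unfolding x_exponent_def by (intro sum.cong) (auto simp: lookup_single when_def)
  then show ?thesis using assms by simp
qed

lemma x_monom_shift:
  assumes "i < n"
  shows "x_monom n (\<alpha> + Poly_Mapping.single i 1) = var (Xvar i) * x_monom n \<alpha>"
  using assms
  by (simp add: x_monom_eq_single x_exponent_add x_exponent_single var_def mult_single add.commute)

text \<open>Multi-indices are ordered lexicographically.\<close>
lemma multi_index_less_shift: "\<beta> < \<beta> + Poly_Mapping.single i (1 :: nat)" for \<beta> :: multi_index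
  unfolding less_poly_mapping.rep_eq less_fun_def
  by (rule exI[of _ i]) (auto simp: lookup_add lookup_single when_def)

text \<open>
  The set \<open>S\<close> is connected to \<open>0\<close> by steps that raise one coordinate, and together with its
  translates by unit vectors it covers all multi-indices of degree at most \<open>d\<close>. The monomials \<open>x\<^sup>\<alpha>\<close>
  with \<open>\<alpha> \<in> S\<close> are, up to sign, the maximal minors of the matrix that has, for each edge of a
  spanning tree of \<open>S\<close>, a row with \<open>1\<close> at the upper end and \<open>- x\<^sub>v\<close> at the lower end. A first row
  holding all the \<open>c\<^sub>\<alpha>\<close> completes this matrix to a representation.
\<close>
lemma uniform_det_rep_of_connected_set:
  fixes S :: "multi_index set"
  assumes S: "finite S" "0 \<in> S"
    and conn: "\<And>\<alpha>. \<alpha> \<in> S \<Longrightarrow> \<alpha> \<noteq> 0 \<Longrightarrow> \<exists>\<beta>\<in>S. \<exists>i<n. \<alpha> = \<beta> + Poly_Mapping.single i 1"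
    and cover: "\<And>\<alpha>. \<alpha> \<in> multi_indices n d \<Longrightarrow>
      \<alpha> \<in> S \<or> (\<exists>\<beta>\<in>S. \<exists>i<n. \<alpha> = \<beta> + Poly_Mapping.single i 1)"
  shows "\<exists>M :: 'k::field cpoly mat. uniform_det_rep n d (card S) M \<and>
    (\<forall>j<card S. c_free_part (M $$ (0, j)) = 0)"
proof -
  define N where "N = card S"
  have N: "0 < N" using S by (auto simp: N_def card_gt_0_iff)
  \<comment> \<open>An enumeration in which every \<open>\<alpha> \<noteq> 0\<close> comes after its parent in the spanning tree.\<close>
  define e where "e j = sorted_list_of_set S ! j" for j
  have e_mono: "e i < e j" if "i < j" "j < N" for i j
    using that sorted_wrt_nth_less[OF strict_sorted_list_of_set[of S]]
    by (simp add: e_def N_def)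
  have e_in: "e j \<in> S" if "j < N" for j
    using that S nth_mem[of j "sorted_list_of_set S"] by (simp add: e_def N_def)
  have e_surj: "\<exists>j<N. e j = \<alpha>" if "\<alpha> \<in> S" for \<alpha>
    using that S in_set_conv_nth[of \<alpha> "sorted_list_of_set S"] by (simp add: e_def N_def)
  have e_less_iff: "e i < e j \<longleftrightarrow> i < j" if "i < N" "j < N" for i j
    using that e_mono by (metis less_asym linorder_neqE_nat less_irrefl)
  have parent: "\<exists>k v. k < j \<and> v < n \<and> e j = e k + Poly_Mapping.single v 1" if j: "j < N" "e j \<noteq> 0" for j
  proof -
    obtain \<beta> v where \<beta>: "\<beta> \<in> S" "v < n" "e j = \<beta> + Poly_Mapping.single v 1"
      using conn[OF e_in[OF j(1)] j(2)] by blast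
    obtain k where k: "k < N" "e k = \<beta>" using e_surj \<beta>(1) by blast
    have "e k < e j" using \<beta>(3) k(2) multi_index_less_shift[of \<beta> v] by simp
    then have "k < j" using e_less_iff k(1) j(1) by blast
    then show ?thesis using \<beta> k by blast
  qed
  have e_0: "e 0 = 0" using parent[OF N] by auto
  have "\<forall>j. \<exists>k v. 0 < j \<and> j < N \<longrightarrow> k < j \<and> v < n \<and> e j = e k + Poly_Mapping.single v 1"
    using parent e_mono e_0 by (metis less_irrefl)
  then obtain p v where pv: "\<And>j. 0 < j \<Longrightarrow> j < N \<Longrightarrow> p j < j \<and> v j < n \<and>
      e j = e (p j) + Poly_Mapping.single (v j) 1"
    by metis
  \<comment> \<open>Each \<open>x\<^sup>\<alpha>\<close> is a monomial of \<open>S\<close>, in column \<open>pos \<alpha>\<close>, times a factor \<open>q \<alpha>\<close> that is \<open>1\<close> or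
    some \<open>x\<^sub>i\<close>.\<close>
  define Q where "Q = insert 1 {var (Xvar i) :: 'k cpoly | i. i < n}"
  have "\<exists>j q. j < N \<and> q \<in> Q \<and> q * x_monom n (e j) = x_monom n \<alpha>" if "\<alpha> \<in> multi_indices n d" for \<alpha>
    using cover[OF that]
  proof
    assume "\<alpha> \<in> S"
    then obtain j where "j < N" "e j = \<alpha>" using e_surj by blast
    then show ?thesis by (intro exI[of _ j] exI[of _ 1]) (auto simp: Q_def)
  next
    assume "\<exists>\<beta>\<in>S. \<exists>i<n. \<alpha> = \<beta> + Poly_Mapping.single i 1"
    then obtain \<beta> i where \<beta>: "\<beta> \<in> S" "i < n" "\<alpha> = \<beta> + Poly_Mapping.single i 1" by blast
    obtain j where j: "j < N" "e j = \<beta>" using e_surj \<beta>(1) by blast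
    have "var (Xvar i) * x_monom n (e j) = (x_monom n \<alpha> :: 'k cpoly)"
      unfolding \<beta>(3) j(2) by (rule x_monom_shift[OF \<beta>(2), symmetric])
    moreover have "var (Xvar i) \<in> Q" using \<beta>(2) by (auto simp: Q_def)
    ultimately show ?thesis using j(1) by blast
  qed
  then obtain pos q where pos: "\<And>\<alpha>. \<alpha> \<in> multi_indices n d \<Longrightarrow>
      pos \<alpha> < N \<and> q \<alpha> \<in> Q \<and> q \<alpha> * x_monom n (e (pos \<alpha>)) = x_monom n \<alpha>"
    by metis
  define c where "c j = (\<Sum>\<alpha>\<in>{\<alpha> \<in> multi_indices n d. pos \<alpha> = j}. var (Cvar \<alpha>) * q \<alpha>)" for j
  define M where "M = mat N N (\<lambda>(i, j). if i = 0 then c j else if j = i then 1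
      else if j = p i then - var (Xvar (v i)) else 0)"
  \<comment> \<open>Multiplication by \<open>T\<close> adds the multiples of the columns by the monomials of \<open>S\<close> into the first
    column, which then has the generic polynomial at the top and zeros below.\<close>
  define T :: "'k cpoly mat"
    where "T = mat N N (\<lambda>(i, j). if j = 0 then x_monom n (e i) else if i = j then 1 else 0)"
  have M: "M \<in> carrier_mat N N" and T: "T \<in> carrier_mat N N" by (simp_all add: M_def T_def)

  have "det T = prod_list (diag_mat T)"
    by (rule det_lower_triangular[OF _ T]) (auto simp: T_def)
  also have "\<dots> = 1"
    unfolding prod_list_diag_prod by (rule prod.neutral) (auto simp: T_def e_0)
  finally have det_T: "det T = 1" .

  have MT_0: "(M * T) $$ (i, 0) = (if i = 0 then generic_poly n d else 0)" if i: "i < N" for i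
  proof -
    have eq: "(M * T) $$ (i, 0) = (\<Sum>j<N. M $$ (i, j) * x_monom n (e j))"
      using i N by (simp add: M_def T_def scalar_prod_def atLeast0LessThan)
    show ?thesis
    proof (cases "i = 0")
      case True
      have "(\<Sum>j<N. M $$ (i, j) * x_monom n (e j)) =
          (\<Sum>j<N. \<Sum>\<alpha>\<in>{\<alpha> \<in> multi_indices n d. pos \<alpha> = j}. var (Cvar \<alpha>) * x_monom n \<alpha>)"
        using N pos by (intro sum.cong)
          (auto simp: True M_def c_def sum_distrib_right mult.assoc intro!: sum.cong)
      also have "\<dots> = generic_poly n d"
        unfolding generic_poly_def using pos by (intro sum.group) (auto simp: finite_multi_indices)
      finally show ?thesis using True eq by simp
    next
      case False
      then have pi: "p i < i" "v i < n" "e i = e (p i) + Poly_Mapping.single (v i) 1"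
        using pv[of i] i by auto
      have "(\<Sum>j<N. M $$ (i, j) * x_monom n (e j)) = (\<Sum>j<N. (if j = i then x_monom n (e i) else 0)
          + (if j = p i then - var (Xvar (v i)) * x_monom n (e (p i)) else 0))"
        using False i pi(1) by (intro sum.cong) (auto simp: M_def)
      also have "\<dots> = x_monom n (e i) - var (Xvar (v i)) * x_monom n (e (p i))"
        using i pi(1) by (simp add: sum.distrib)
      also have "\<dots> = 0" using pi(2) unfolding pi(3) x_monom_shift[OF pi(2)] by simp
      finally show ?thesis using False eq by simp
    qed
  qed
  have MT_Suc: "(M * T) $$ (i, j) = M $$ (i, j)" if "i < N" "j < N" "j \<noteq> 0" for i j
  proof -
    have "(M * T) $$ (i, j) = (\<Sum>l<N. M $$ (i, l) * (if l = j then 1 else 0))"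
      using that M by (simp add: T_def scalar_prod_def atLeast0LessThan)
    then show ?thesis using that by (simp add: if_distrib cong: if_cong)
  qed
  have MT: "M * T \<in> carrier_mat N N" using M T by simp
  define L where "L = mat_delete (M * T) 0 0"
  have L: "L \<in> carrier_mat (N - 1) (N - 1)" using M T by (simp add: L_def mat_delete_def)
  have L_entry: "L $$ (i, j) = M $$ (Suc i, Suc j)" if "i < N - 1" "j < N - 1" for i j
    using that M T by (simp add: L_def mat_delete_def MT_Suc del: index_mult_mat(1))
  have "det L = prod_list (diag_mat L)"
  proof (rule det_lower_triangular[OF _ L])
    fix i j assume ij: "i < j" "j < N - 1"
    then have "p (Suc i) < Suc i" using pv[of "Suc i"] by simp
    then show "L $$ (i, j) = 0" using ij by (simp add: L_entry M_def)
  qed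
  also have "\<dots> = 1"
    unfolding prod_list_diag_prod using L
    by (intro prod.neutral) (auto simp: L_entry M_def)
  finally have det_L: "det L = 1" .

  have "det M = det (M * T)" using det_mult[OF M T] det_T by simp
  also have "\<dots> = (\<Sum>i<N. (if i = 0 then generic_poly n d * cofactor (M * T) 0 0 else 0))"
    unfolding laplace_expansion_column[OF MT N] by (intro sum.cong) (auto simp: MT_0)
  also have "\<dots> = generic_poly n d" using N det_L by (simp add: cofactor_def L_def)
  finally have det_M: "det M = generic_poly n d" .

  have c_span: "c j \<in> cpoly.span (allowed_monomials n d)" for j
    unfolding c_def
  proof (intro cpoly.span_sum cpoly.span_base)
    fix \<alpha> assume "\<alpha> \<in> {\<alpha> \<in> multi_indices n d. pos \<alpha> = j}"
    then show "var (Cvar \<alpha>) * q \<alpha> \<in> allowed_monomials n d"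
      using pos[of \<alpha>] by (auto simp: Q_def allowed_monomials_def)
  qed
  have "M $$ (i, j) \<in> cpoly.span (allowed_monomials n d)" if ij: "i < N" "j < N" for i j
  proof (cases "i = 0")
    case False
    then have "v i < n" using pv[of i] ij by simp
    then have "- var (Xvar (v i)) \<in> cpoly.span (allowed_monomials n d :: 'k cpoly set)"
      by (intro cpoly.span_neg cpoly.span_base) (auto simp: allowed_monomials_def)
    moreover have "1 \<in> cpoly.span (allowed_monomials n d :: 'k cpoly set)"
      by (intro cpoly.span_base) (simp add: allowed_monomials_def)
    ultimately show ?thesis using ij False by (simp add: M_def cpoly.span_zero)
  qed (use ij c_span in \<open>simp add: M_def\<close>)
  then have "uniform_det_rep n d N M" using M det_M by (simp add: uniform_det_rep_def)
  moreover have "c_free_part (M $$ (0, j)) = 0" if "j < N" for j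
    using that N by (simp add: M_def c_def c_free_part.hom_sum c_free_part_mult)
  ultimately show ?thesis unfolding N_def by blast
qed

section \<open>A connected covering set of density one over n\<close>

text \<open>
  Modulo \<open>n\<close>, the weight is a colouring of the multi-indices with \<open>n\<close> colours in which adding the
  unit vectors to a multi-index yields every colour exactly once.
\<close>
definition lattice_weight :: "nat \<Rightarrow> multi_index \<Rightarrow> nat" where
  "lattice_weight n \<alpha> = (\<Sum>i<n. i * Poly_Mapping.lookup \<alpha> i)"

text \<open>
  The multi-indices of degree at most \<open>d\<close> whose weight is divisible by \<open>n\<close>, a fraction of about
  \<open>1 / n\<close>, and those on the coordinate hyperplanes, which are of lower order in number.
\<close>
definition connected_cover :: "nat \<Rightarrow> nat \<Rightarrow> multi_index set" where
  "connected_cover n d = {\<alpha> \<in> multi_indices n d.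
     n dvd lattice_weight n \<alpha> \<or> (\<exists>i<n. Poly_Mapping.lookup \<alpha> i = 0)}"

lemma lattice_weight_shift:
  assumes "i < n"
  shows "lattice_weight n (\<alpha> + Poly_Mapping.single i 1) = lattice_weight n \<alpha> + i"
proof -
  have "lattice_weight n (\<alpha> + Poly_Mapping.single i 1) =
      (\<Sum>j<n. j * Poly_Mapping.lookup \<alpha> j + (if j = i then i else 0))"
    unfolding lattice_weight_def
    by (intro sum.cong) (auto simp: lookup_add lookup_single when_def algebra_simps)
  then show ?thesis using assms by (simp add: sum.distrib lattice_weight_def)
qed

lemma sum_lookup_shift:
  fixes \<alpha> :: multi_index
  assumes "i < n"
  shows "(\<Sum>j<n. Poly_Mapping.lookup (\<alpha> + Poly_Mapping.single i 1) j) =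
    (\<Sum>j<n. Poly_Mapping.lookup \<alpha> j) + 1"
proof -
  have "(\<Sum>j<n. Poly_Mapping.lookup (\<alpha> + Poly_Mapping.single i (1::nat)) j) =
      (\<Sum>j<n. Poly_Mapping.lookup \<alpha> j + (if j = i then 1 else 0))"
    by (intro sum.cong) (auto simp: lookup_add lookup_single when_def)
  then show ?thesis using assms by (simp add: sum.distrib)
qed

lemma multi_index_unshift:
  assumes "\<alpha> \<in> multi_indices n d" "i < n" "Poly_Mapping.lookup \<alpha> i \<noteq> 0"
  obtains \<beta> where "\<beta> \<in> multi_indices n d" "\<alpha> = \<beta> + Poly_Mapping.single i 1"
proof
  let ?\<beta> = "\<alpha> - Poly_Mapping.single i 1"
  show eq: "\<alpha> = ?\<beta> + Poly_Mapping.single i 1"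
    using assms(3) by (intro poly_mapping_eqI)
      (auto simp: lookup_add lookup_single minus_poly_mapping.rep_eq when_def)
  have "(\<Sum>j<n. Poly_Mapping.lookup \<alpha> j) = (\<Sum>j<n. Poly_Mapping.lookup ?\<beta> j) + 1"
    by (subst eq) (rule sum_lookup_shift[OF assms(2)])
  moreover have "Poly_Mapping.keys ?\<beta> \<subseteq> Poly_Mapping.keys \<alpha>"
    by (auto simp: in_keys_iff minus_poly_mapping.rep_eq)
  ultimately show "?\<beta> \<in> multi_indices n d"
    using assms(1) by (auto simp: multi_indices_def)
qed

text \<open>
  On a coordinate hyperplane any positive coordinate can be lowered. Elsewhere coordinate \<open>0\<close>,
  which does not contribute to the weight, can be lowered.
\<close>
lemma connected_cover_connected:
  assumes n: "n \<ge> 1" and \<alpha>: "\<alpha> \<in> connected_cover n d" "\<alpha> \<noteq> 0"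
  shows "\<exists>\<beta>\<in>connected_cover n d. \<exists>i<n. \<alpha> = \<beta> + Poly_Mapping.single i 1"
proof (cases "\<exists>i<n. Poly_Mapping.lookup \<alpha> i = 0")
  case True
  then obtain i where i: "i < n" "Poly_Mapping.lookup \<alpha> i = 0" by blast
  have in_MI: "\<alpha> \<in> multi_indices n d" using \<alpha> by (simp add: connected_cover_def)
  obtain k where k: "k \<in> Poly_Mapping.keys \<alpha>" using \<alpha>(2) by (metis ex_in_conv keys_eq_empty)
  have "k < n" using k in_MI by (auto simp: multi_indices_def)
  moreover have "Poly_Mapping.lookup \<alpha> k \<noteq> 0" using k by (simp add: in_keys_iff)
  ultimately obtain \<beta> where \<beta>: "\<beta> \<in> multi_indices n d" "\<alpha> = \<beta> + Poly_Mapping.single k 1"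
    using multi_index_unshift[OF in_MI] by blast
  have "Poly_Mapping.lookup \<beta> i = 0" using i(2) by (simp add: \<beta>(2) lookup_add)
  then show ?thesis using \<beta> i \<open>k < n\<close> by (auto simp: connected_cover_def)
next
  case False
  have in_MI: "\<alpha> \<in> multi_indices n d" using \<alpha> by (simp add: connected_cover_def)
  obtain \<beta> where \<beta>: "\<beta> \<in> multi_indices n d" "\<alpha> = \<beta> + Poly_Mapping.single 0 1"
    using multi_index_unshift[OF in_MI, of 0] False n by auto
  have "n dvd lattice_weight n \<alpha>" using \<alpha> False by (auto simp: connected_cover_def)
  then have "n dvd lattice_weight n \<beta>" using \<beta>(2) lattice_weight_shift[of 0 n \<beta>] n by simp
  then show ?thesis using \<beta> n by (intro bexI[of _ \<beta>] exI[of _ 0]) (auto simp: connected_cover_def)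
qed

lemma connected_cover_covers:
  assumes n: "n \<ge> 1" and \<alpha>: "\<alpha> \<in> multi_indices n d"
  shows "\<alpha> \<in> connected_cover n d \<or> (\<exists>\<beta>\<in>connected_cover n d. \<exists>i<n. \<alpha> = \<beta> + Poly_Mapping.single i 1)"
proof (cases "\<alpha> \<in> connected_cover n d")
  case False
  define r where "r = lattice_weight n \<alpha> mod n"
  have r: "r < n" using n by (simp add: r_def)
  moreover have "Poly_Mapping.lookup \<alpha> r \<noteq> 0"
    using False \<alpha> r by (auto simp: connected_cover_def)
  ultimately obtain \<beta> where \<beta>: "\<beta> \<in> multi_indices n d" "\<alpha> = \<beta> + Poly_Mapping.single r 1"
    using multi_index_unshift[OF \<alpha>] by blast
  have "lattice_weight n \<beta> = lattice_weight n \<alpha> - r"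
    using lattice_weight_shift[OF r, of \<beta>] \<beta>(2) by simp
  then have "n dvd lattice_weight n \<beta>" by (simp add: r_def minus_mod_eq_mult_div)
  then show ?thesis using \<beta> r by (auto simp: connected_cover_def)
qed simp

text \<open>
  The pairs of a multi-index of weight divisible by \<open>n\<close> and a unit vector inject by addition into
  the multi-indices of degree at most \<open>d + 1\<close>, as the weight of the sum determines the unit vector.
\<close>
lemma card_lattice_points:
  assumes n: "n \<ge> 1"
  shows "n * card {\<alpha> \<in> multi_indices n d. n dvd lattice_weight n \<alpha>} \<le> card (multi_indices n (d + 1))"
proof -
  let ?A = "{\<alpha> \<in> multi_indices n d. n dvd lattice_weight n \<alpha>}"
  let ?shift = "\<lambda>(\<alpha> :: multi_index, i). \<alpha> + Poly_Mapping.single i 1"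
  have residue: "lattice_weight n (?shift (\<alpha>, i)) mod n = i" if "\<alpha> \<in> ?A" "i < n" for \<alpha> i
    using that lattice_weight_shift[of i n \<alpha>] by auto
  have "inj_on ?shift (?A \<times> {..<n})"
  proof (rule inj_onI, clarify)
    fix \<alpha> \<beta> i j
    assume *: "i < n" "j < n" "\<alpha> \<in> multi_indices n d" "n dvd lattice_weight n \<alpha>"
      "\<beta> \<in> multi_indices n d" "n dvd lattice_weight n \<beta>"
      "\<alpha> + Poly_Mapping.single i 1 = \<beta> + Poly_Mapping.single j 1"
    then have "i = j" using residue[of \<alpha> i] residue[of \<beta> j] by simp
    with * show "\<alpha> = \<beta> \<and> i = j" by simp
  qed
  moreover have "?shift ` (?A \<times> {..<n}) \<subseteq> multi_indices n (d + 1)"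
  proof clarify
    fix \<alpha> i assume *: "i < n" "\<alpha> \<in> multi_indices n d" 
    have "Poly_Mapping.keys (\<alpha> + Poly_Mapping.single i 1) \<subseteq> {..<n}"
      using * keys_add[of \<alpha> "Poly_Mapping.single i 1"] by (auto simp: multi_indices_def)
    then show "\<alpha> + Poly_Mapping.single i 1 \<in> multi_indices n (d + 1)"
      using * sum_lookup_shift[OF *(1), of \<alpha>] by (simp add: multi_indices_def)
  qed
  ultimately have "card (?A \<times> {..<n}) \<le> card (multi_indices n (d + 1))"
    using finite_multi_indices by (rule card_inj_on_le)
  then show ?thesis by (simp add: card_cartesian_product mult.commute)
qed

lemma card_coordinate_hyperplane:
  assumes i: "i < n"
  shows "card {\<alpha> \<in> multi_indices n d. Poly_Mapping.lookup \<alpha> i = 0} \<le> (d + 1) ^ (n - 1)"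
proof -
  let ?A = "{\<alpha> \<in> multi_indices n d. Poly_Mapping.lookup \<alpha> i = 0}" and ?I = "{..<n} - {i}"
  let ?f = "\<lambda>\<alpha>. restrict (Poly_Mapping.lookup \<alpha>) ?I"
  have "inj_on ?f ?A"
  proof (rule inj_onI)
    fix \<alpha> \<beta> assume *: "\<alpha> \<in> ?A" "\<beta> \<in> ?A" "?f \<alpha> = ?f \<beta>"
    show "\<alpha> = \<beta>"
    proof (rule poly_mapping_eqI)
      fix j
      consider "j \<in> ?I" | "j = i" | "j \<ge> n" by force
      then show "Poly_Mapping.lookup \<alpha> j = Poly_Mapping.lookup \<beta> j"
      proof cases
        case 1
        then show ?thesis using fun_cong[OF *(3), of j] by simp
      next
        case 3
        then have "j \<notin> Poly_Mapping.keys \<alpha>" "j \<notin> Poly_Mapping.keys \<beta>"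
          using * by (auto simp: multi_indices_def)
        then show ?thesis by (simp add: in_keys_iff)
      qed (use * in auto)
    qed
  qed
  moreover have "?f ` ?A \<subseteq> (\<Pi>\<^sub>E j\<in>?I. {..d})"
  proof (clarify, intro PiE_I)
    fix \<alpha> j assume "\<alpha> \<in> multi_indices n d" "j \<in> ?I"
    then have "Poly_Mapping.lookup \<alpha> j \<le> (\<Sum>j<n. Poly_Mapping.lookup \<alpha> j)"
      "(\<Sum>j<n. Poly_Mapping.lookup \<alpha> j) \<le> d"
      by (auto simp: multi_indices_def intro!: member_le_sum)
    then show "?f \<alpha> j \<in> {..d}" using \<open>j \<in> ?I\<close> by simp
  qed auto
  ultimately have "card ?A \<le> card (\<Pi>\<^sub>E j\<in>?I. {..d})"
    by (rule card_inj_on_le) (auto intro!: finite_PiE)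
  also have "\<dots> = (d + 1) ^ (n - 1)" using i by (simp add: card_PiE)
  finally show ?thesis .
qed

lemma card_connected_cover:
  assumes "n \<ge> 1"
  shows "n * card (connected_cover n d) \<le> card (multi_indices n (d + 1)) + n * n * (d + 1) ^ (n - 1)"
proof -
  have "connected_cover n d = {\<alpha> \<in> multi_indices n d. n dvd lattice_weight n \<alpha>} \<union>
      (\<Union>i<n. {\<alpha> \<in> multi_indices n d. Poly_Mapping.lookup \<alpha> i = 0})" (is "_ = ?A \<union> ?B")
    by (auto simp: connected_cover_def)
  then have "card (connected_cover n d) \<le> card ?A + card ?B" by (simp add: card_Un_le)
  moreover have "card ?B \<le> (\<Sum>i<n. card {\<alpha> \<in> multi_indices n d. Poly_Mapping.lookup \<alpha> i = 0})"
    by (rule card_UN_le) simp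
  moreover have "\<dots> \<le> (\<Sum>i<n. (d + 1) ^ (n - 1))"
    by (intro sum_mono card_coordinate_hyperplane) simp
  ultimately have "card (connected_cover n d) \<le> card ?A + n * (d + 1) ^ (n - 1)" by simp
  then have "n * card (connected_cover n d) \<le> n * (card ?A + n * (d + 1) ^ (n - 1))"
    by (rule mult_le_mono2)
  also have "\<dots> = n * card ?A + n * n * (d + 1) ^ (n - 1)" by (simp add: algebra_simps)
  finally show ?thesis using card_lattice_points[OF assms, of d] by simp
qed

section \<open>Asymptotics of the sizes\<close>

lemma card_multi_indices: "card (multi_indices n d) = (n + d) choose n"
proof -
  \<comment> \<open>A last entry turns the degree bound into an equation.\<close>
  let ?L = "{l :: nat list. length l = Suc n \<and> sum_list l = d}"
  define to_list where
    "to_list \<alpha> = map (Poly_Mapping.lookup \<alpha>) [0..<n] @ [d - (\<Sum>i<n. Poly_Mapping.lookup \<alpha> i)]"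
    for \<alpha> :: multi_index
  define of_list where
    "of_list l = Abs_poly_mapping (\<lambda>i. if i < n then l ! i else 0)" for l :: "nat list"
  have lookup_of_list: "Poly_Mapping.lookup (of_list l) i = (if i < n then l ! i else 0)" for l i
    unfolding of_list_def by (subst lookup_Abs_poly_mapping) auto
  have sum_list_butlast: "sum_list l = (\<Sum>i<n. l ! i) + l ! n" if "length l = Suc n" for l :: "nat list"
    using that by (simp add: sum_list_sum_nth atLeast0LessThan)
  have "bij_betw to_list (multi_indices n d) ?L"
  proof (rule bij_betw_byWitness[where f' = of_list])
    show "\<forall>\<alpha>\<in>multi_indices n d. of_list (to_list \<alpha>) = \<alpha>"
    proof
      fix \<alpha> assume \<alpha>: "\<alpha> \<in> multi_indices n d"
      have "Poly_Mapping.lookup \<alpha> i = 0" if "\<not> i < n" for i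
        using \<alpha> that by (auto simp: multi_indices_def in_keys_iff)
      then show "of_list (to_list \<alpha>) = \<alpha>"
        by (intro poly_mapping_eqI) (auto simp: lookup_of_list to_list_def nth_append)
    qed
    show "\<forall>l\<in>?L. to_list (of_list l) = l"
    proof clarify
      fix l :: "nat list" assume l: "length l = Suc n"
      have "to_list (of_list l) ! i = l ! i" if "i < Suc n" "d = sum_list l" for i
        using that l
        by (cases "i = n") (auto simp: to_list_def nth_append lookup_of_list sum_list_butlast)
      then show "d = sum_list l \<Longrightarrow> to_list (of_list l) = l"
        using l by (intro nth_equalityI) (auto simp: to_list_def)
    qed
    show "to_list ` multi_indices n d \<subseteq> ?L"
      by (auto simp: to_list_def multi_indices_def interv_sum_list_conv_sum_set_nat atLeast0LessThan)
    show "of_list ` ?L \<subseteq> multi_indices n d"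
      by (auto simp: multi_indices_def in_keys_iff lookup_of_list sum_list_butlast split: if_splits)
  qed
  then have "card (multi_indices n d) = card ?L" by (rule bij_betw_same_card)
  also have "\<dots> = (d + n) choose d" using card_length_sum_list[of "Suc n" d] by simp
  also have "\<dots> = (n + d) choose n" using binomial_symmetric[of d "d + n"] by (simp add: add.commute)
  finally show ?thesis .
qed

lemma power_le_fact_times_binomial: "d ^ n \<le> fact n * ((n + d) choose n)"
proof (induction n)
  case (Suc n)
  have "d ^ Suc n \<le> (Suc n + d) * (fact n * ((n + d) choose n))"
    unfolding power_Suc using Suc by (intro mult_le_mono) auto
  also have "\<dots> = fact n * (Suc (n + d) * ((n + d) choose n))" by (simp add: algebra_simps)
  also have "Suc (n + d) * ((n + d) choose n) = (Suc (n + d) choose Suc n) * Suc n"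
    by (rule Suc_times_binomial_eq)
  finally show ?case by (simp add: algebra_simps)
qed simp

lemma power_add_le:
  fixes x a :: real
  assumes "x \<ge> 0" "a \<ge> 0"
  shows "(x + a) ^ n \<le> x ^ n + real n * a * (x + a) ^ (n - 1)"
proof (induction n)
  case (Suc n)
  have pow: "(x + a) * (real n * a * (x + a) ^ (n - 1)) = real n * a * (x + a) ^ n"
    by (cases n) auto
  have "(x + a) ^ Suc n \<le> (x + a) * (x ^ n + real n * a * (x + a) ^ (n - 1))"
    unfolding power_Suc using Suc assms by (intro mult_left_mono) auto
  also have "\<dots> = x ^ Suc n + a * x ^ n + real n * a * (x + a) ^ n"
    unfolding distrib_left pow by (simp add: algebra_simps)
  also have "\<dots> \<le> x ^ Suc n + a * (x + a) ^ n + real n * a * (x + a) ^ n"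
    using assms by (intro add_mono mult_left_mono power_mono) auto
  finally show ?case by (simp add: algebra_simps)
qed simp

lemma size_lower_bound:
  assumes n: "n \<ge> 1" and "card (multi_indices n d) \<le> n * N + 1"
  shows "real N \<ge> 1 / (real n * fact n) * real d ^ n + (- 1 / real n)"
proof -
  have "d ^ n \<le> fact n * (n * N + 1)"
    using power_le_fact_times_binomial[of d n] assms(2)
    unfolding card_multi_indices by (meson le_trans mult_le_mono2)
  then have "real (d ^ n) \<le> real (fact n * (n * N + 1))" by (rule of_nat_mono)
  then show ?thesis using n by (simp add: field_simps)
qed

lemma size_upper_bound:
  assumes n: "n \<ge> 1" and d: "d \<ge> 1"
    and size: "n * N \<le> card (multi_indices n (d + 1)) + n * n * (d + 1) ^ (n - 1)"
  shows "real N \<le> 1 / (real n * fact n) * real d ^ n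
    + (real (n + 1) * real (n + 2) ^ (n - 1) + real n * 2 ^ (n - 1)) * real d ^ (n - 1)"
proof -
  let ?D = "real d ^ (n - 1)"
  have "card (multi_indices n (d + 1)) * fact n \<le> (d + (n + 1)) ^ n"
    unfolding card_multi_indices using binomial_fact_pow[of "n + (d + 1)" n] by (simp add: ac_simps)
  then have "real (card (multi_indices n (d + 1)) * fact n) \<le> real ((d + (n + 1)) ^ n)"
    by (rule of_nat_mono)
  then have "real (card (multi_indices n (d + 1))) * fact n \<le> (real d + real (n + 1)) ^ n" by (simp add: ac_simps)
  also have "\<dots> \<le> real d ^ n + real n * real (n + 1) * (real d + real (n + 1)) ^ (n - 1)"
    by (rule power_add_le) auto
  also have "(real d + real (n + 1)) ^ (n - 1) \<le> (real (n + 2) * real d) ^ (n - 1)"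
  proof (rule power_mono)
    have "real (n + 1) * 1 \<le> real (n + 1) * real d" using d by (intro mult_left_mono) auto
    then show "real d + real (n + 1) \<le> real (n + 2) * real d" by (simp add: algebra_simps)
  qed simp
  finally have card: "real (card (multi_indices n (d + 1))) * fact n
      \<le> real d ^ n + real n * real (n + 1) * (real (n + 2) ^ (n - 1) * ?D)"
    using n by (simp add: power_mult_distrib mult_left_mono)
  have "real (d + 1) ^ (n - 1) \<le> (2 * real d) ^ (n - 1)" using d by (intro power_mono) auto
  then have bd: "real (d + 1) ^ (n - 1) \<le> 2 ^ (n - 1) * ?D" by (simp add: power_mult_distrib)
  have "real (n * N) \<le> real (card (multi_indices n (d + 1)) + n * n * (d + 1) ^ (n - 1))"
    using size by (rule of_nat_mono)
  then have "real n * real N \<le> real (card (multi_indices n (d + 1))) + real n * real n * real (d + 1) ^ (n - 1)"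
    by simp
  also have "\<dots> \<le> (real d ^ n + real n * real (n + 1) * (real (n + 2) ^ (n - 1) * ?D)) / fact n
      + real n * real n * (2 ^ (n - 1) * ?D)"
    using card bd by (intro add_mono mult_left_mono) (auto simp: pos_le_divide_eq)
  also have "\<dots> \<le> real d ^ n / fact n + real n * real (n + 1) * (real (n + 2) ^ (n - 1) * ?D)
      + real n * real n * (2 ^ (n - 1) * ?D)"
  proof -
    have "z / fact n \<le> z" if "z \<ge> 0" for z :: real
      using that mult_left_mono[of 1 "fact n" z] by (simp add: pos_divide_le_eq fact_ge_1)
    from this[of "real n * real (n + 1) * (real (n + 2) ^ (n - 1) * ?D)"] show ?thesis
      by (simp add: add_divide_distrib)
  qed
  also have "\<dots> = real n * (1 / (real n * fact n) * real d ^ n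
    + (real (n + 1) * real (n + 2) ^ (n - 1) + real n * 2 ^ (n - 1)) * ?D)"
    using n by (simp add: field_simps)
  finally show ?thesis using n by simp
qed

lemma const_bigo_power: "(\<lambda>_. c :: real) \<in> O(\<lambda>d. real d ^ k)"
proof (rule bigoI[of _ "\<bar>c\<bar>"])
  show "\<forall>\<^sub>F d in at_top. norm c \<le> \<bar>c\<bar> * norm (real d ^ k)"
    using eventually_ge_at_top[of 1]
  proof eventually_elim
    case (elim d)
    have "1 \<le> real d ^ k" using elim by (intro one_le_power) simp
    then show ?case using mult_left_mono[of 1 "real d ^ k" "\<bar>c\<bar>"] by simp
  qed
qed

section \<open>The optimal size\<close>

theorem theorem4p5:
  fixes n :: nat
  assumes "n \<ge> 1"
  shows
    "(\<exists>N :: nat \<Rightarrow> nat.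
        (\<lambda>d. real (N d) - 1 / (real n * fact n) * real d ^ n) \<in> O(\<lambda>d. real d ^ (n - 1)) \<and>
        (\<forall>d. \<exists>M :: 'k::field cpoly mat.
           uniform_det_rep n d (N d) M \<and>
           singular_space (matrix_space n (N d) (M0_part M)) \<and>
           compression_space (N d) (matrix_space n (N d) (M0_part M)) \<and>
           (\<exists>U. compression_witness (N d) (matrix_space n (N d) (M0_part M)) U \<and>
                vec_dim (N d) U = 1)))
     \<and>
     (\<exists>g :: nat \<Rightarrow> real.
        g \<in> O(\<lambda>d. real d ^ (n - 1)) \<and>
        (\<forall>d N. \<forall>M :: 'k cpoly mat.
           uniform_det_rep n d N M \<and>
           compression_space N (matrix_space n N (M0_part M)) \<and>
           (\<exists>U. compression_witness N (matrix_space n N (M0_part M)) U \<and>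
                vec_dim N U = 1)
           \<longrightarrow> real N \<ge> 1 / (real n * fact n) * real d ^ n + g d))"
proof (intro conjI exI[of _ "\<lambda>d. card (connected_cover n d)"] exI[of _ "\<lambda>_. - 1 / real n"] allI impI)
  let ?N = "\<lambda>d. card (connected_cover n d)"
  have S: "finite (connected_cover n d)" "0 \<in> connected_cover n d" for d
    using finite_multi_indices[of n d] by (simp_all add: connected_cover_def zero_in_multi_indices lattice_weight_def)
  have ex: "\<exists>M :: 'k cpoly mat. uniform_det_rep n d (?N d) M \<and>
           singular_space (matrix_space n (?N d) (M0_part M)) \<and>
           compression_space (?N d) (matrix_space n (?N d) (M0_part M)) \<and>
           (\<exists>U. compression_witness (?N d) (matrix_space n (?N d) (M0_part M)) U \<and>
                vec_dim (?N d) U = 1)" for d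
  proof -
    obtain M :: "'k cpoly mat" where M: "uniform_det_rep n d (?N d) M"
      "\<And>j. j < ?N d \<Longrightarrow> c_free_part (M $$ (0, j)) = 0"
      using uniform_det_rep_of_connected_set[OF S, of d n d]
        connected_cover_connected[OF assms] connected_cover_covers[OF assms] by metis
    have "M \<in> carrier_mat (?N d) (?N d)" using M(1) by (simp add: uniform_det_rep_def)
    moreover have "0 < ?N d" using S by (auto simp: card_gt_0_iff)
    ultimately have "M0_part M \<in> carrier_mat (?N d) (?N d)" "0 < ?N d"
      "\<And>j. j < ?N d \<Longrightarrow> M0_part M $$ (0, j) = 0"
      using M(2) by (auto simp: M0_part_def)
    note zero_row_witness[OF this]
    with M(1) show ?thesis by blast
  qed
  then show "\<exists>M :: 'k cpoly mat. uniform_det_rep n d (?N d) M \<and>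
           singular_space (matrix_space n (?N d) (M0_part M)) \<and>
           compression_space (?N d) (matrix_space n (?N d) (M0_part M)) \<and>
           (\<exists>U. compression_witness (?N d) (matrix_space n (?N d) (M0_part M)) U \<and>
                vec_dim (?N d) U = 1)" for d .
  show lower: "real N \<ge> 1 / (real n * fact n) * real d ^ n + (- 1 / real n)"
    if "uniform_det_rep n d N M \<and>
           compression_space N (matrix_space n N (M0_part M)) \<and>
           (\<exists>U. compression_witness N (matrix_space n N (M0_part M)) U \<and>
                vec_dim N U = 1)" for d N and M :: "'k cpoly mat"
    using that one_dim_witness_card_bound size_lower_bound[OF assms] by blast
  show "(\<lambda>_. - 1 / real n) \<in> O(\<lambda>d. real d ^ (n - 1))" by (rule const_bigo_power)
  let ?K = "real (n + 1) * real (n + 2) ^ (n - 1) + real n * 2 ^ (n - 1)"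
  \<comment> \<open>The size is bounded from below because the constructed representations are themselves subject
    to the lower bound.\<close>
  show "(\<lambda>d. real (?N d) - 1 / (real n * fact n) * real d ^ n) \<in> O(\<lambda>d. real d ^ (n - 1))"
  proof (rule bigoI[of _ "?K + 1"])
    show "\<forall>\<^sub>F d in at_top. norm (real (?N d) - 1 / (real n * fact n) * real d ^ n)
        \<le> (?K + 1) * norm (real d ^ (n - 1))"
      using eventually_ge_at_top[of 1]
    proof eventually_elim
      case (elim d)
      have D: "1 \<le> real d ^ (n - 1)" using elim by (intro one_le_power) simp
      have "real (?N d) \<le> 1 / (real n * fact n) * real d ^ n + ?K * real d ^ (n - 1)"
        by (rule size_upper_bound[OF assms elim card_connected_cover[OF assms]])
      moreover have "real (?N d) \<ge> 1 / (real n * fact n) * real d ^ n + (- 1 / real n)"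
        using ex[of d] lower by blast
      moreover have "1 / real n \<le> 1" using assms by simp
      moreover have "0 \<le> ?K * real d ^ (n - 1)" by simp
      ultimately have "\<bar>real (?N d) - 1 / (real n * fact n) * real d ^ n\<bar>
          \<le> ?K * real d ^ (n - 1) + real d ^ (n - 1)"
        using D by linarith
      then show ?case by (simp add: distrib_right)
    qed
  qed
qed

end
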